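(* Let $m\geq0$, $r\geq2$ and $0\leq i\leq r-1$ be integers. Then \[ \sum_{s_1\geq\dots\geq s_{r}\geq-\lfloor m/2\rfloor}\frac{q^{s_1^2/2+s_2^2+\dots+s_{r}^2+m(s_1/2+s_2+\dots+s_{r-1})+s_1/2-(s_1+\dots+s_{i})}(-q^{m/2})_{s_1}}{(q)_{s_1-s_2}\cdots(q)_{s_{r-1}-s_{r}}}(-1)^{s_r}q^{\binom{s_r}{2}}\begin{bmatrix}m+s_r\\ m+2s_r\end{bmatrix}=c_m, \] where (the sum on the left running over integers $s_1,\dots,s_r$, and $s_1+\dots+s_i=0$ when $i=0$) for every integer $p\ge0$, \[ c_{2p}=\frac{(-q^p)_\infty}{2(q)_\infty}\sum_{k=0}^{2i}\sum_{\ell=0}^{2p}(-1)^\ell q^{pk+p\ell}(q^{2r},q^{2pr+r-i-p+k+\ell},q^{r+i-2pr+p-k-\ell};q^{2r})_\infty, \] \[ c_{2p+1}=(-1)^pq^{(1-r)p^2+(1+2i-2r)p/2}\frac{(-q^{(2p+1)/2})_\infty}{(q)_\infty}\sum_{\ell=0}^{p}q^{\ell}(q^{2r},q^{2r-i-p+2\ell-1/2},q^{i+p-2\ell+1/2};q^{2r})_\infty. \]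
   Context: $q$ is a complex number with $|q|<1$ and $q^{1/2}$ is a fixed square root, with $q^{x/2}=(q^{1/2})^x$ for integers $x$. For complex $y$ and base $p'$ with $|p'|<1$, $(y;p')_\infty=\prod_{j\ge0}(1-yp'^j)$, $(y;p')_k=(y;p')_\infty/(yp'^k;p')_\infty$ for $k\in\mathbb{Z}$, $(y)_k=(y;q)_k$, $(y)_\infty=(y;q)_\infty$, and $(y_1,\dots,y_m;p')_\infty=\prod_i(y_i;p')_\infty$. For integers $N\ge0$ and $j$, $\begin{bmatrix}N\\ j\end{bmatrix}=\frac{(q)_N}{(q)_j(q)_{N-j}}$ if $0\le j\le N$ and $0$ otherwise.
   Formalization: The exponent is corrected to m(s_1/2+s_2+…+s_r) instead of ending at s_{r-1}; as printed the identity fails (m=r=2, i=0, q→0: left side tends to 1, c_2 ~ -1/(2q)), and both agree for m≤1. Also q≠0 is assumed, since negative powers of q occur. *)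

theory Defs
  imports "HOL-Analysis.Analysis"
begin

definition qpoch_inf :: "complex \<Rightarrow> complex \<Rightarrow> complex" where
  "qpoch_inf y b = (\<Prod>j. 1 - y * b ^ j)"

definition qpochs_inf :: "complex list \<Rightarrow> complex \<Rightarrow> complex" where
  "qpochs_inf ys b = prod_list (map (\<lambda>y. qpoch_inf y b) ys)"

definition qpoch :: "complex \<Rightarrow> complex \<Rightarrow> int \<Rightarrow> complex" where
  "qpoch y b k = qpoch_inf y b / qpoch_inf (y * b powi k) b"

definition qbinom :: "complex \<Rightarrow> int \<Rightarrow> int \<Rightarrow> complex" where
  "qbinom q N j = (if 0 \<le> j \<and> j \<le> N
     then qpoch q q N / (qpoch q q j * qpoch q q (N - j)) else 0)"

definition index_tuples :: "nat \<Rightarrow> nat \<Rightarrow> (nat \<Rightarrow> int) set" where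
  "index_tuples m r = {s \<in> {1..r} \<rightarrow>\<^sub>E UNIV. (\<forall>j\<in>{1..<r}. s (j + 1) \<le> s j) \<and> - int (m div 2) \<le> s r}"

text \<open>
  Throughout, \<open>h\<close> is the chosen square root \<open>q\<^bsup>1/2\<^esup>\<close> and \<open>q\<^bsup>x/2\<^esup>\<close> is rendered as \<open>h powi x\<close>.
  Thus the function below is twice the exponent
  \<open>s\<^sub>1\<^sup>2/2 + s\<^sub>2\<^sup>2 + \<dots> + s\<^sub>r\<^sup>2 + m (s\<^sub>1/2 + s\<^sub>2 + \<dots> + s\<^sub>r) + s\<^sub>1/2 - (s\<^sub>1 + \<dots> + s\<^sub>i)\<close>.
  The sum multiplied by \<open>m\<close> must run up to \<open>s\<^sub>r\<close>. In the source it is printed as ending at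
  \<open>s\<^bsub>r-1\<^esub>\<close>, and with that exponent the identity fails for \<open>m \<ge> 2\<close>: for \<open>m = r = 2\<close>, \<open>i = 0\<close>
  the printed left side tends to \<open>1\<close> as \<open>q\<close> tends to \<open>0\<close>, while the right side
  behaves like \<open>-1/(2q)\<close>. For \<open>m \<le> 1\<close> only \<open>s\<^sub>r = 0\<close> contributes and the two agree.
\<close>

definition twice_exponent :: "nat \<Rightarrow> nat \<Rightarrow> nat \<Rightarrow> (nat \<Rightarrow> int) \<Rightarrow> int" where
  "twice_exponent m r i s =
     (s 1)\<^sup>2 + 2 * (\<Sum>j=2..r. (s j)\<^sup>2) + int m * (s 1 + 2 * (\<Sum>j=2..r. s j))
     + s 1 - 2 * (\<Sum>j=1..i. s j)"

definition c_even :: "complex \<Rightarrow> nat \<Rightarrow> nat \<Rightarrow> nat \<Rightarrow> complex" where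
  "c_even q r i p =
     qpoch_inf (- (q ^ p)) q / (2 * qpoch_inf q q) *
     (\<Sum>k=0..2*i. \<Sum>l=0..2*p. (-1) ^ l * q ^ (p * k + p * l) *
        qpochs_inf
          [q ^ (2 * r),
           q powi (2 * int p * int r + int r - int i - int p + int k + int l),
           q powi (int r + int i - 2 * int p * int r + int p - int k - int l)]
          (q ^ (2 * r)))"

definition c_odd :: "complex \<Rightarrow> complex \<Rightarrow> nat \<Rightarrow> nat \<Rightarrow> nat \<Rightarrow> complex" where
  "c_odd q h r i p =
     (-1) ^ p * h powi (2 * (1 - int r) * (int p)\<^sup>2 + (1 + 2 * int i - 2 * int r) * int p) *
     (qpoch_inf (- (h ^ (2 * p + 1))) q / qpoch_inf q q) *
     (\<Sum>l=0..p. q ^ l *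
        qpochs_inf
          [q ^ (2 * r),
           h powi (4 * int r - 2 * int i - 2 * int p + 4 * int l - 1),
           h powi (2 * int i + 2 * int p - 4 * int l + 1)]
          (q ^ (2 * r)))"

definition c_val :: "complex \<Rightarrow> complex \<Rightarrow> nat \<Rightarrow> nat \<Rightarrow> nat \<Rightarrow> complex" where
  "c_val q h r i m = (if even m then c_even q r i (m div 2) else c_odd q h r i (m div 2))"

end

theory Submission
  imports Defs
begin

text \<open>
  For the pair \<open>\<alpha>\<^sub>t = (-1)\<^sup>t q\<^bsup>t(t-1)/2\<^esup>\<close>, \<open>t \<in> \<int>\<close>, the bilateral Bailey transform relative to
  \<open>q\<^sup>m\<close> is, by the q-binomial theorem, the summand in \<open>s\<^sub>r\<close>. Each of the sums over
  \<open>s\<^sub>r, \<dots>, s\<^bsub>i+1\<^esub>\<close> is an ordinary Bailey step. The sums over \<open>s\<^sub>i, \<dots>, s\<^sub>2\<close> have weights belonging to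
  \<open>q\<^bsup>m-1\<^esup>\<close>; changing the base would divide by \<open>1 - q\<^bsup>m+2t\<^esup>\<close>, which vanishes at \<open>t = -m/2\<close>, so
  instead the kernel is carried along as a polynomial in \<open>y = q\<^bsup>m+2t\<^esup>\<close>. The sum over \<open>s\<^sub>1\<close> is a
  limiting case of the q-Gauss sum and leaves, with \<open>x = q\<^bsup>m/2+t\<^esup>\<close>,
  \<open>\<Sum>\<^sub>t (-1)\<^sup>t q\<^bsup>rt\<^sup>2+(r-1/2)mt-it\<^esup> (1 + x + \<dots> + x\<^bsup>2i\<^esup>) / (1 + x)\<close>.
  Averaging over \<open>t \<mapsto> -m - t\<close> turns the quotient into a polynomial in \<open>x\<close>, and the Jacobi triple
  product evaluates each resulting theta series.
\<close>

section \<open>q-series preliminaries\<close>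

text \<open>Reading 1/(q)_k as 0 for k < 0 makes the kernel \<open>bU\<close> vanish unless -m-n <=
  j <= n, and makes it zero for all j when n < -m/2; this is where the bound s_r >= -floor(m/2)
  comes from. The obstacle is that lowering the exponent by s_j costs a factor 1 + y - q^(m+n+j)
  that still depends on the outer index n. What saves the iteration is that q^(m+n+j), met by the
  next lowered weight, turns that weight back into the ordinary one. Hence two known sums suffice at
  each step, and a two-term closed form \<open>bG\<close> covers any number of steps. The sum over
  s_1 works by the same mechanism. The inner sums are finite. The infinite rearrangements are the
  grouping of tuples by s_1 and the exchange of the sums over s_1 and t; both rest on absolute
  summability, the quadratic exponents dominating linear terms of either sign. For odd m the
  averaged polynomial collapses to two families of powers of x, exchanged by the reflection of t.
  That is why c_(2p+1) has a single sum and no factor 1/2.\<close>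

text \<open>With the exponent identity as a premise of its own, products of powers reduce to integer
  identities that \<open>algebra_simps\<close> settles.\<close>

lemma powi_eq_mult:
  fixes x :: "'a :: field"
  assumes "x \<noteq> 0" "c = a + b"
  shows "x powi c = x powi a * x powi b"
  using assms by (simp add: power_int_add)

lemma two_choose_two: "2 * int (t choose 2) = int t * (int t - 1)"
proof (induction t)
  case (Suc t)
  have "Suc t choose 2 = t + (t choose 2)" by (simp add: numeral_2_eq_2)
  thus ?case using Suc.IH by (simp add: algebra_simps)
qed (simp add: binomial_eq_0)

section \<open>Finite and infinite q-shifted factorials\<close>

definition qfin :: "complex \<Rightarrow> complex \<Rightarrow> nat \<Rightarrow> complex" where
  "qfin z q n = (\<Prod>i<n. 1 - z * q ^ i)"

lemma qfin_0 [simp]: "qfin z q 0 = 1"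
  and qfin_Suc: "qfin z q (Suc n) = qfin z q n * (1 - z * q ^ n)"
  by (simp_all add: qfin_def)

lemma qfin_Suc_shift: "qfin z q (Suc n) = (1 - z) * qfin (z * q) q n"
  unfolding qfin_def by (subst prod.lessThan_Suc_shift) (simp add: mult_ac)

lemma qfin_add: "qfin z q (m + n) = qfin z q m * qfin (z * q ^ m) q n"
  by (induction n) (simp_all add: qfin_Suc power_add mult_ac)

lemma norm_power_lt_1:
  fixes x :: real
  assumes "0 \<le> x" "x < 1" "k > 0"
  shows "x ^ k < 1"
proof -
  obtain n where "k = Suc n" using assms(3) gr0_implies_Suc by blast
  thus ?thesis using power_Suc_le_self[of x n] assms by simp
qed

lemma norm_q_powi_lt_1:
  fixes q :: complex
  assumes "norm q < 1" "q \<noteq> 0" "k > 0"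
  shows "norm (q powi k) < 1"
proof -
  have "norm (q powi k) = norm q ^ nat k"
    using assms by (simp add: norm_power power_int_nonneg_exp)
  also have "\<dots> < 1" using assms by (intro norm_power_lt_1) auto
  finally show ?thesis .
qed

lemma q_power_neq_1:
  fixes q :: complex
  assumes "norm q < 1" "k > 0"
  shows "q ^ k \<noteq> 1"
proof
  assume "q ^ k = 1"
  hence "norm q ^ k = 1" by (metis norm_one norm_power)
  thus False using norm_power_lt_1[of "norm q" k] assms by simp
qed

lemma convergent_prod_q:
  fixes q z :: complex
  assumes "norm q < 1"
  shows "convergent_prod (\<lambda>i. 1 - z * q ^ i)"
proof (rule abs_convergent_prod_imp_convergent_prod)
  have "summable (\<lambda>i. norm z * norm q ^ i)"
    using assms by (intro summable_mult summable_geometric) auto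
  thus "abs_convergent_prod (\<lambda>i. 1 - z * q ^ i)"
    by (simp add: abs_convergent_prod_conv_summable norm_mult norm_power)
qed

lemma qfin_tendsto:
  assumes "norm q < 1"
  shows "qfin z q \<longlonglongrightarrow> qpoch_inf z q"
  unfolding qfin_def [abs_def] qpoch_inf_def
  using convergent_prod_q[OF assms] convergent_prod_has_prod has_prod_imp_tendsto' by blast

lemma qpoch_inf_split:
  assumes "norm q < 1"
  shows "qpoch_inf z q = qfin z q n * qpoch_inf (z * q ^ n) q"
proof -
  have "(\<lambda>k. qfin z q (n + k)) \<longlonglongrightarrow> qpoch_inf z q"
    using LIMSEQ_ignore_initial_segment[OF qfin_tendsto[OF assms], of z n] by (simp add: add.commute)
  moreover have "(\<lambda>k. qfin z q (n + k)) \<longlonglongrightarrow> qfin z q n * qpoch_inf (z * q ^ n) q"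
    unfolding qfin_add by (intro tendsto_intros qfin_tendsto assms)
  ultimately show ?thesis by (rule LIMSEQ_unique)
qed

lemma qpoch_inf_nonzero:
  assumes "norm q < 1" "\<And>i. z * q ^ i \<noteq> 1"
  shows "qpoch_inf z q \<noteq> 0"
  unfolding qpoch_inf_def
  by (rule prodinf_nonzero[OF convergent_prod_q[OF assms(1)]]) (use assms(2) in auto)

lemma mult_power_neq_1:
  fixes z q :: complex
  assumes "norm q < 1" "norm z < 1 \<or> z = -1"
  shows "z * q ^ i \<noteq> 1"
proof
  assume eq: "z * q ^ i = 1"
  hence n: "norm z * norm q ^ i = 1" by (metis norm_mult norm_one norm_power)
  have le: "norm q ^ i \<le> 1" using assms by (intro power_le_one) auto
  show False
  proof (cases "norm z < 1")
    case True
    have "norm z * norm q ^ i \<le> norm z * 1" by (intro mult_left_mono le) auto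
    thus False using True n by simp
  next
    case False
    hence z: "z = -1" using assms by auto
    hence "norm q ^ i = 1" using n by simp
    hence "i = 0" using norm_power_lt_1[of "norm q" i] assms by (cases "i = 0") auto
    thus False using eq z by simp
  qed
qed

lemma qfin_nonzero:
  assumes "\<And>i. z * q ^ i \<noteq> 1"
  shows "qfin z q n \<noteq> 0"
  using assms by (auto simp: qfin_def)

lemma qfin_bounded:
  assumes "norm q < 1"
  obtains K where "K > 0" "\<And>n. norm (qfin z q n) \<le> K"
proof -
  have "Bseq (qfin z q)"
    using qfin_tendsto[OF assms] convergentI convergent_imp_Bseq by blast
  thus ?thesis using that unfolding Bseq_def by blast
qed

text \<open>The value \<open>0\<close> at negative \<open>k\<close> is what makes all sums below terminate naturally.\<close>

definition rq :: "complex \<Rightarrow> int \<Rightarrow> complex" where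
  "rq q k = (if k < 0 then 0 else inverse (qfin q q (nat k)))"

lemma rq_neg [simp]: "k < 0 \<Longrightarrow> rq q k = 0"
  and rq_0 [simp]: "rq q 0 = 1"
  and rq_nat: "rq q (int n) = inverse (qfin q q n)"
  by (simp_all add: rq_def)

lemma qfin_q_nonzero:
  assumes "norm q < 1"
  shows "qfin q q n \<noteq> 0"
  using mult_power_neq_1[OF assms] assms by (intro qfin_nonzero) auto

lemma qpoch_inf_q_nonzero:
  assumes "norm q < 1"
  shows "qpoch_inf q q \<noteq> 0"
  using mult_power_neq_1[OF assms] assms by (intro qpoch_inf_nonzero) auto

text \<open>Valid for every integer k: at k = 0 the factor 1 - q^k kills the left side just as
  \<open>rq q (-1) = 0\<close> kills the right. Sums can thus be shifted without separating boundary
  terms; this recurrence drives the summation formulas below.\<close>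

lemma rq_rec:
  assumes "norm q < 1"
  shows "rq q k * (1 - q powi k) = rq q (k - 1)"
proof (cases "k \<le> 0")
  case True
  thus ?thesis by (cases "k = 0") auto
next
  case False
  define n where "n = nat (k - 1)"
  have k: "k = int (Suc n)" using False by (simp add: n_def)
  have e1: "rq q k = inverse (qfin q q (Suc n))"
    unfolding k by (rule rq_nat)
  have e2: "rq q (k - 1) = inverse (qfin q q n)"
    by (simp add: k rq_nat)
  have e3: "q powi k = q ^ Suc n" unfolding k by (rule power_int_of_nat)
  have "1 - q * q ^ n \<noteq> 0" using q_power_neq_1[OF assms, of "Suc n"] by auto
  thus ?thesis unfolding e1 e2 e3 qfin_Suc by simp
qed

lemma rq_bounded:
  assumes "norm q < 1"
  obtains K where "K > 0" "\<And>k. norm (rq q k) \<le> K"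
proof -
  have "(\<lambda>n. inverse (qfin q q n)) \<longlonglongrightarrow> inverse (qpoch_inf q q)"
    by (intro tendsto_inverse qfin_tendsto assms qpoch_inf_q_nonzero)
  hence "Bseq (\<lambda>n. inverse (qfin q q n))" by (metis convergentI convergent_imp_Bseq)
  then obtain K where K: "K > 0" "\<And>n. norm (inverse (qfin q q n)) \<le> K" by (auto simp: Bseq_def)
  hence "norm (rq q k) \<le> K" for k by (auto simp: rq_def less_imp_le)
  thus ?thesis using that K by blast
qed

lemma rq_tendsto:
  assumes "norm q < 1"
  shows "(\<lambda>n. rq q (int n + c)) \<longlonglongrightarrow> inverse (qpoch_inf q q)"
proof -
  have 1: "(\<lambda>n. inverse (qfin q q n)) \<longlonglongrightarrow> inverse (qpoch_inf q q)"
    by (intro tendsto_inverse qfin_tendsto assms qpoch_inf_q_nonzero)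
  have "filterlim (\<lambda>n. nat (int n + c)) at_top at_top"
    unfolding filterlim_at_top
  proof
    fix Z
    show "\<forall>\<^sub>F n in at_top. Z \<le> nat (int n + c)"
      using eventually_ge_at_top[of "Z + nat \<bar>c\<bar>"] by eventually_elim linarith
  qed
  from filterlim_compose[OF 1 this]
  have "(\<lambda>n. inverse (qfin q q (nat (int n + c)))) \<longlonglongrightarrow> inverse (qpoch_inf q q)" .
  moreover have "\<forall>\<^sub>F n in at_top. inverse (qfin q q (nat (int n + c))) = rq q (int n + c)"
    using eventually_ge_at_top[of "nat \<bar>c\<bar>"] by eventually_elim (auto simp: rq_def)
  ultimately show ?thesis by (rule Lim_transform_eventually)
qed

section \<open>The q-binomial theorem and two q-Chu-Vandermonde sums\<close>

text \<open>The expansion of (z;q)_N divided by (q)_N. The induction is the q-Pascal rule: 1 -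
  q^(N+1) is distributed over the two reciprocal factorials, each of which then drops by
  one.\<close>

lemma q_binomial:
  fixes q z :: complex
  assumes q: "norm q < 1" "q \<noteq> 0"
  shows "(\<Sum>t\<le>N. (-1) ^ t * q ^ (t choose 2) * z ^ t * rq q (int t) * rq q (int N - int t))
    = rq q (int N) * qfin z q N"
proof (induction N)
  case (Suc N)
  define f where "f t = (-1) ^ t * q ^ (t choose 2) * z ^ t" for t
  define S where "S N = (\<Sum>t\<le>N. f t * rq q (int t) * rq q (int N - int t))" for N
  have IH: "S N = rq q (int N) * qfin z q N" using Suc.IH by (simp add: S_def f_def)
  have nz: "1 - q powi int (Suc N) \<noteq> 0"
    using q_power_neq_1[OF q(1), of "Suc N"] by (simp del: of_nat_Suc)
  \<comment> \<open>Uses 1 - q^(N+1) = (1 - q^(N+1-t)) + q^(N+1-t) (1 - q^t); by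
    \<open>rq_rec\<close> the first part lowers N + 1 - t and the second lowers t.\<close>
  have split: "f t * rq q (int t) * rq q (int (Suc N) - int t) * (1 - q powi int (Suc N))
      = f t * rq q (int t) * rq q (int N - int t)
      + f t * q powi (int (Suc N) - int t) * rq q (int t - 1) * rq q (int (Suc N) - int t)" for t
  proof -
    have "q powi int (Suc N) = q powi (int (Suc N) - int t) * q powi int t"
      by (rule powi_eq_mult) (use q in auto)
    hence *: "1 - q powi int (Suc N) = (1 - q powi (int (Suc N) - int t))
        + q powi (int (Suc N) - int t) * (1 - q powi int t)" by (simp add: algebra_simps)
    have a: "rq q (int (Suc N) - int t) * (1 - q powi (int (Suc N) - int t)) = rq q (int N - int t)"
      using rq_rec[OF q(1), of "int (Suc N) - int t"] by (simp add: algebra_simps)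
    have b: "rq q (int t) * (1 - q powi int t) = rq q (int t - 1)" by (rule rq_rec[OF q(1)])
    show ?thesis unfolding * a[symmetric] b[symmetric] by (simp add: algebra_simps)
  qed
  have shift: "f (Suc t) * q powi (int (Suc N) - int (Suc t)) = - z * q ^ N * f t" if "t \<le> N" for t
  proof -
    have "int (Suc N) - int (Suc t) = int (N - t)" using that by simp
    hence "q powi (int (Suc N) - int (Suc t)) = q ^ (N - t)" by (simp only: power_int_of_nat)
    moreover have "q ^ N = q ^ (N - t) * q ^ t" using that by (simp flip: power_add)
    moreover have "Suc t choose 2 = t + (t choose 2)" by (simp add: numeral_2_eq_2)
    ultimately show ?thesis by (simp add: f_def power_add)
  qed
  have "S (Suc N) * (1 - q powi int (Suc N)) =
     (\<Sum>t\<le>Suc N. f t * rq q (int t) * rq q (int N - int t))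
     + (\<Sum>t\<le>Suc N. f t * q powi (int (Suc N) - int t) * rq q (int t - 1) * rq q (int (Suc N) - int t))"
    unfolding S_def sum_distrib_right split sum.distrib ..
  also have "(\<Sum>t\<le>Suc N. f t * rq q (int t) * rq q (int N - int t)) = S N"
    unfolding S_def by simp
  also have "(\<Sum>t\<le>Suc N. f t * q powi (int (Suc N) - int t) * rq q (int t - 1) * rq q (int (Suc N) - int t))
     = (\<Sum>t\<le>N. (f (Suc t) * q powi (int (Suc N) - int (Suc t))) * rq q (int (Suc t) - 1) * rq q (int (Suc N) - int (Suc t)))"
    by (subst sum.atMost_Suc_shift) simp
  also have "\<dots> = (\<Sum>t\<le>N. (- z * q ^ N) * (f t * rq q (int t) * rq q (int N - int t)))"
    by (intro sum.cong refl, subst shift) (auto simp: algebra_simps)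
  also have "\<dots> = - z * q ^ N * S N" unfolding S_def by (simp only: sum_distrib_left)
  finally have "S (Suc N) * (1 - q powi int (Suc N)) = (1 - z * q ^ N) * S N"
    by (simp add: algebra_simps)
  also have "\<dots> = rq q (int (Suc N)) * (1 - q powi int (Suc N)) * qfin z q (Suc N)"
    using rq_rec[OF q(1), of "int (Suc N)"] by (simp add: IH qfin_Suc)
  finally have "S (Suc N) * (1 - q powi int (Suc N))
     = rq q (int (Suc N)) * qfin z q (Suc N) * (1 - q powi int (Suc N))" by (simp only: mult_ac)
  hence "S (Suc N) = rq q (int (Suc N)) * qfin z q (Suc N)" using nz mult_right_cancel by blast
  thus ?case unfolding S_def f_def .
qed (simp_all add: binomial_eq_0)

text \<open>The same distribution of 1 - q^(N+1); its second half is the sum for N with M + 1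
  instead of M, hence the arbitrary M in the induction. M is an integer because it will be m + 2j
  with j of either sign; for M < 0 the terms with l < -M vanish.\<close>

lemma q_vandermonde:
  fixes q :: complex
  assumes q: "norm q < 1" "q \<noteq> 0"
  shows "(\<Sum>l\<le>N. q powi (int l * (int l + M)) * rq q (int N - int l) * rq q (int l) * rq q (M + int l))
    = rq q (int N) * rq q (M + int N)"
proof (induction N arbitrary: M)
  case (Suc N)
  define f where "f M l = q powi (int l * (int l + M))" for M l
  define S where "S N M = (\<Sum>l\<le>N. f M l * rq q (int N - int l) * rq q (int l) * rq q (M + int l))" for N M
  have IH: "S N M = rq q (int N) * rq q (M + int N)" for M using Suc.IH by (simp add: S_def f_def)
  have nz: "1 - q powi int (Suc N) \<noteq> 0"
    using q_power_neq_1[OF q(1), of "Suc N"] by (simp del: of_nat_Suc)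
  have split: "f M l * rq q (int (Suc N) - int l) * rq q (int l) * rq q (M + int l) * (1 - q powi int (Suc N))
      = f M l * rq q (int N - int l) * rq q (int l) * rq q (M + int l)
      + f M l * q powi (int (Suc N) - int l) * rq q (int (Suc N) - int l) * rq q (int l - 1) * rq q (M + int l)" for l
  proof -
    have "q powi int (Suc N) = q powi (int (Suc N) - int l) * q powi int l"
      by (rule powi_eq_mult) (use q in auto)
    hence *: "1 - q powi int (Suc N) = (1 - q powi (int (Suc N) - int l))
        + q powi (int (Suc N) - int l) * (1 - q powi int l)" by (simp add: algebra_simps)
    have a: "rq q (int (Suc N) - int l) * (1 - q powi (int (Suc N) - int l)) = rq q (int N - int l)"
      using rq_rec[OF q(1), of "int (Suc N) - int l"] by (simp add: algebra_simps)
    have b: "rq q (int l) * (1 - q powi int l) = rq q (int l - 1)" by (rule rq_rec[OF q(1)])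
    show ?thesis unfolding * a[symmetric] b[symmetric] by (simp add: algebra_simps)
  qed
  have shift: "f M (Suc l) * q powi (int (Suc N) - int (Suc l)) = q powi (M + int (Suc N)) * f (M + 1) l" for l
    unfolding f_def power_int_add[symmetric, OF disjI1[OF q(2)]]
    by (rule arg_cong[where f = "power_int q"]) (simp add: algebra_simps)
  have "S (Suc N) M * (1 - q powi int (Suc N)) =
     (\<Sum>l\<le>Suc N. f M l * rq q (int N - int l) * rq q (int l) * rq q (M + int l))
     + (\<Sum>l\<le>Suc N. f M l * q powi (int (Suc N) - int l) * rq q (int (Suc N) - int l) * rq q (int l - 1) * rq q (M + int l))"
    unfolding S_def sum_distrib_right split sum.distrib ..
  also have "(\<Sum>l\<le>Suc N. f M l * rq q (int N - int l) * rq q (int l) * rq q (M + int l)) = S N M"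
    unfolding S_def by simp
  also have "(\<Sum>l\<le>Suc N. f M l * q powi (int (Suc N) - int l) * rq q (int (Suc N) - int l) * rq q (int l - 1) * rq q (M + int l))
     = (\<Sum>l\<le>N. f M (Suc l) * q powi (int (Suc N) - int (Suc l)) * rq q (int (Suc N) - int (Suc l)) * rq q (int (Suc l) - 1) * rq q (M + int (Suc l)))"
    by (subst sum.atMost_Suc_shift) simp
  also have "\<dots> = q powi (M + int (Suc N)) * S N (M + 1)"
    unfolding shift S_def sum_distrib_left by (intro sum.cong refl) (simp add: algebra_simps)
  finally have "S (Suc N) M * (1 - q powi int (Suc N))
     = rq q (int N) * (rq q (M + int N) + q powi (M + int (Suc N)) * rq q (M + int (Suc N)))"
    by (simp add: IH algebra_simps)
  also have "rq q (M + int N) = rq q (M + int (Suc N)) * (1 - q powi (M + int (Suc N)))"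
    using rq_rec[OF q(1), of "M + int (Suc N)"] by simp
  also have "rq q (int N) = rq q (int (Suc N)) * (1 - q powi int (Suc N))"
    using rq_rec[OF q(1), of "int (Suc N)"] by simp
  finally have "S (Suc N) M * (1 - q powi int (Suc N))
     = rq q (int (Suc N)) * rq q (M + int (Suc N)) * (1 - q powi int (Suc N))"
    by (simp add: algebra_simps)
  hence "S (Suc N) M = rq q (int (Suc N)) * rq q (M + int (Suc N))" using nz mult_right_cancel by blast
  thus ?case unfolding S_def f_def .
qed (simp_all add: binomial_eq_0)

text \<open>Since 1/(q)_l = q^l/(q)_l + 1/(q)_(l-1), the sum is the unshifted one plus, after l -> l
  + 1, q^M times the unshifted one for N - 1 and M + 1. The factor is therefore 1 + q^M (1 -
  q^N).\<close>

lemma q_vandermonde_shifted: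
  fixes q :: complex
  assumes q: "norm q < 1" "q \<noteq> 0"
  shows "(\<Sum>l\<le>N. q powi (int l * (int l + M) - int l) * rq q (int N - int l) * rq q (int l) * rq q (M + int l))
    = (1 + q powi M - q powi (M + int N)) * rq q (int N) * rq q (M + int N)"
proof -
  have tm: "q powi (int l * (int l + M) - int l) * rq q (int N - int l) * rq q (int l) * rq q (M + int l)
     = q powi (int l * (int l + M)) * rq q (int N - int l) * rq q (int l) * rq q (M + int l)
     + q powi (int l * (int l + M) - int l) * rq q (int N - int l) * rq q (int l - 1) * rq q (M + int l)" for l
  proof -
    have 1: "q powi (int l * (int l + M)) = q powi (int l * (int l + M) - int l) * q powi int l"
      by (rule powi_eq_mult) (use q in auto)
    have b: "rq q (int l - 1) = rq q (int l) * (1 - q powi int l)" by (rule rq_rec[OF q(1), symmetric])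
    show ?thesis unfolding 1 b by (simp add: algebra_simps)
  qed
  have tail: "(\<Sum>l\<le>N. q powi (int l * (int l + M) - int l) * rq q (int N - int l) * rq q (int l - 1) * rq q (M + int l))
     = q powi M * rq q (int N - 1) * rq q (M + int N)"
  proof (cases N)
    case (Suc n)
    have shift: "q powi (int (Suc l) * (int (Suc l) + M) - int (Suc l)) = q powi M * q powi (int l * (int l + (M + 1)))" for l
      by (rule powi_eq_mult) (use q in \<open>auto simp: algebra_simps\<close>)
    have "(\<Sum>l\<le>N. q powi (int l * (int l + M) - int l) * rq q (int N - int l) * rq q (int l - 1) * rq q (M + int l))
       = (\<Sum>l\<le>n. q powi (int (Suc l) * (int (Suc l) + M) - int (Suc l)) * rq q (int N - int (Suc l)) * rq q (int (Suc l) - 1) * rq q (M + int (Suc l)))"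
      unfolding Suc by (subst sum.atMost_Suc_shift) simp
    also have "\<dots> = q powi M * (\<Sum>l\<le>n. q powi (int l * (int l + (M + 1))) * rq q (int n - int l) * rq q (int l) * rq q ((M + 1) + int l))"
      unfolding shift sum_distrib_left by (intro sum.cong refl) (simp add: Suc algebra_simps)
    also have "\<dots> = q powi M * rq q (int N - 1) * rq q (M + int N)"
      unfolding q_vandermonde[OF q] by (simp add: Suc algebra_simps)
    finally show ?thesis .
  qed simp
  have b: "rq q (int N - 1) = rq q (int N) * (1 - q powi int N)" by (rule rq_rec[OF q(1), symmetric])
  have c: "q powi (M + int N) = q powi M * q powi int N" by (rule powi_eq_mult) (use q in auto)
  show ?thesis unfolding tm sum.distrib q_vandermonde[OF q] tail b c by (simp add: algebra_simps)
qed

section \<open>Limiting q-Gauss sum and Jacobi triple product\<close>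

lemma summable_geometric_int:
  fixes \<rho> :: real
  assumes "0 \<le> \<rho>" "\<rho> < 1"
  shows "(\<lambda>t::int. \<rho> ^ nat \<bar>t\<bar>) summable_on UNIV"
proof -
  have g: "(\<lambda>n. \<rho> ^ n) summable_on UNIV"
    using assms by (intro norm_summable_imp_summable_on) (auto simp: norm_power intro: summable_geometric)
  have "(\<lambda>t::int. \<rho> ^ nat \<bar>t\<bar>) summable_on range int"
    by (subst summable_on_reindex) (auto simp: o_def g)
  moreover have "(\<lambda>t::int. \<rho> ^ nat \<bar>t\<bar>) summable_on range (\<lambda>n. - int n)"
    by (subst summable_on_reindex) (auto simp: o_def g inj_on_def)
  ultimately have "(\<lambda>t::int. \<rho> ^ nat \<bar>t\<bar>) summable_on (range int \<union> (range (\<lambda>n. - int n) - range int))"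
    by (intro summable_on_Un_disjoint) (auto intro: summable_on_subset)
  moreover have "t \<in> range int \<union> (range (\<lambda>n. - int n) - range int)" for t
  proof (cases "t \<ge> 0")
    case True thus ?thesis by (auto intro: rangeI[of int "nat t"] simp: image_iff intro!: exI[of _ "nat t"])
  next
    case False
    hence "t = - int (nat (-t))" by simp
    thus ?thesis by blast
  qed
  hence "range int \<union> (range (\<lambda>n. - int n) - range int) = UNIV" by blast
  ultimately show ?thesis by simp
qed

lemma norm_powi_le:
  fixes h :: complex
  assumes "norm h < 1" "h \<noteq> 0" "\<bar>t\<bar> - c \<le> e"
  shows "norm (h powi e) \<le> norm h powi (- c) * norm h ^ nat \<bar>t\<bar>"
proof -
  have "norm (h powi e) = norm h powi e" by (simp add: norm_power_int)
  also have "\<dots> \<le> norm h powi (\<bar>t\<bar> - c)"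
    using assms by (intro power_int_decreasing) auto
  also have "\<dots> = norm h powi (- c) * norm h powi \<bar>t\<bar>"
    by (rule powi_eq_mult) (use assms in auto)
  also have "norm h powi \<bar>t\<bar> = norm h ^ nat \<bar>t\<bar>" by (simp add: power_int_nonneg_exp)
  finally show ?thesis .
qed

text \<open>From t^2 + (B+1)^2 >= 2 (B+1) |t|: the square absorbs the linear term and leaves a
  surplus of |t|. With \<open>norm_powi_le\<close> this bounds a power of h with quadratic exponent
  by a constant times |h|^|t|.\<close>

lemma quadratic_ge_abs:
  fixes t b :: int
  assumes "a \<ge> 1" "\<bar>b\<bar> \<le> B"
  shows "\<bar>t\<bar> - (B + 1)\<^sup>2 \<le> a * t\<^sup>2 + b * t"
proof -
  have "0 \<le> (\<bar>t\<bar> - (B + 1))\<^sup>2 + (B + 1) * \<bar>t\<bar>" using assms by (intro add_nonneg_nonneg) auto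
  hence 1: "(B + 1) * \<bar>t\<bar> \<le> t\<^sup>2 + (B + 1)\<^sup>2"
    by (simp add: power2_eq_square algebra_simps abs_mult_self_eq)
  have "\<bar>b * t\<bar> \<le> B * \<bar>t\<bar>" using assms by (simp add: abs_mult mult_right_mono)
  hence 2: "- (B * \<bar>t\<bar>) \<le> b * t" by linarith
  have 3: "1 * t\<^sup>2 \<le> a * t\<^sup>2" using assms by (intro mult_right_mono) auto
  from 1 2 3 show ?thesis by (simp add: algebra_simps)
qed

lemma summable_prod_tuples:
  fixes g :: "int \<Rightarrow> real"
  assumes "g summable_on UNIV" "\<And>t. g t \<ge> 0" "finite I"
  shows "(\<lambda>s. \<Prod>k\<in>I. g (s k)) summable_on (I \<rightarrow>\<^sub>E UNIV)"
proof -
  have "Infinite_Set_Sum.abs_summable_on g UNIV"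
    using assms by (simp flip: abs_summable_equivalent)
  hence "Infinite_Set_Sum.abs_summable_on (\<lambda>s. \<Prod>k\<in>I. g (s k)) (I \<rightarrow>\<^sub>E UNIV)"
    using assms by (intro abs_summable_on_prod_PiE) auto
  hence "(\<lambda>s. norm (\<Prod>k\<in>I. g (s k))) summable_on (I \<rightarrow>\<^sub>E UNIV)"
    by (simp flip: abs_summable_equivalent)
  thus ?thesis by (rule abs_summable_summable)
qed

lemma summable_qpow_choose:
  fixes \<rho> A :: real
  assumes "0 \<le> \<rho>" "\<rho> < 1" "A \<ge> 0"
  shows "summable (\<lambda>l. \<rho> ^ (l choose 2) * A ^ l)"
proof -
  have "(\<lambda>l. \<rho> ^ l * A) \<longlonglongrightarrow> 0 * A"
    using assms by (intro tendsto_mult tendsto_const LIMSEQ_realpow_zero)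
  hence "\<forall>\<^sub>F l in at_top. \<rho> ^ l * A < 1 / 2" by (rule order_tendstoD) simp
  then obtain N where N: "\<And>l. l \<ge> N \<Longrightarrow> \<rho> ^ l * A < 1 / 2" by (auto simp: eventually_at_top_linorder)
  show ?thesis
  proof (rule summable_ratio_test[of "1 / 2" N])
    fix l assume "l \<ge> N"
    have "Suc l choose 2 = l + (l choose 2)" by (simp add: numeral_2_eq_2)
    hence "\<rho> ^ (Suc l choose 2) * A ^ Suc l = (\<rho> ^ l * A) * (\<rho> ^ (l choose 2) * A ^ l)"
      by (simp add: power_add mult_ac)
    also have "\<dots> \<le> 1 / 2 * (\<rho> ^ (l choose 2) * A ^ l)"
      using N[OF \<open>l \<ge> N\<close>] assms by (intro mult_right_mono) auto
    finally show "norm (\<rho> ^ (Suc l choose 2) * A ^ Suc l) \<le> 1 / 2 * norm (\<rho> ^ (l choose 2) * A ^ l)"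
      using assms by simp
  qed simp
qed

section \<open>A limiting case of the q-Gauss sum\<close>

text \<open>The term of 2phi1(a, c/z; c; q, z/a) as a tends to infinity. Merging (c/z)_l z^l into
  one product avoids the division by z.\<close>

definition gauss_term :: "complex \<Rightarrow> complex \<Rightarrow> complex \<Rightarrow> nat \<Rightarrow> complex" where
  "gauss_term q z c l = (-1) ^ l * q ^ (l choose 2) * (\<Prod>i<l. z - c * q ^ i) * rq q (int l) / qfin c q l"

context
  fixes q z c :: complex
  assumes q: "norm q < 1" and c: "\<And>i. c * q ^ i \<noteq> 1"
begin

text \<open>Uniformity in n is what Tannery's theorem needs in \<open>q_gauss_limit\<close>.
  Shifting z and c by q^n takes (q^n)^l out of the product, and 1/(c q^n)_l = (c)_n/(c)_(n+l) stays
  bounded because (c)_n has a nonzero limit.\<close>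

lemma gauss_term_bound:
  "\<exists>K>0. \<forall>n l. norm (gauss_term q (z * q ^ n) (c * q ^ n) l)
     \<le> K * (norm q ^ (l choose 2) * (norm z + norm c) ^ l) * norm (q ^ n) ^ l"
proof -
  obtain K1 where K1: "K1 > 0" "\<And>k. norm (rq q k) \<le> K1" using rq_bounded[OF q] by metis
  obtain K2 where K2: "K2 > 0" "\<And>n. norm (qfin c q n) \<le> K2" using qfin_bounded[OF q] by metis
  have nz: "qfin c q n \<noteq> 0" for n by (rule qfin_nonzero) (rule c)
  have "(\<lambda>n. inverse (qfin c q n)) \<longlonglongrightarrow> inverse (qpoch_inf c q)"
    by (intro tendsto_inverse qfin_tendsto q qpoch_inf_nonzero c)
  hence "Bseq (\<lambda>n. inverse (qfin c q n))" by (metis convergentI convergent_imp_Bseq)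
  then obtain K3 where K3: "K3 > 0" "\<And>n. norm (inverse (qfin c q n)) \<le> K3" by (auto simp: Bseq_def)
  show ?thesis
  proof (intro exI[of _ "K1 * (K2 * K3)"] conjI allI)
    show "K1 * (K2 * K3) > 0" using K1 K2 K3 by simp
    fix n l
    have inv: "inverse (qfin (c * q ^ n) q l) = qfin c q n * inverse (qfin c q (n + l))"
      using nz[of n] nz[of "n + l"] by (simp add: qfin_add)
    have P: "(\<Prod>i<l. z * q ^ n - c * q ^ n * q ^ i) = (q ^ n) ^ l * (\<Prod>i<l. z - c * q ^ i)"
    proof -
      have "(\<Prod>i<l. z * q ^ n - c * q ^ n * q ^ i) = (\<Prod>i<l. q ^ n * (z - c * q ^ i))"
        by (intro prod.cong) (auto simp: algebra_simps)
      thus ?thesis by (simp add: prod.distrib)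
    qed
    have "norm (\<Prod>i<l. z - c * q ^ i) = (\<Prod>i<l. norm (z - c * q ^ i))" by (simp add: prod_norm)
    also have "\<dots> \<le> (\<Prod>i<l. norm z + norm c)"
    proof (intro prod_mono conjI)
      fix i
      have "norm (z - c * q ^ i) \<le> norm z + norm c * norm q ^ i"
        by (metis norm_triangle_ineq4 norm_mult norm_power)
      also have "norm c * norm q ^ i \<le> norm c * 1"
        using q by (intro mult_left_mono power_le_one) auto
      finally show "norm (z - c * q ^ i) \<le> norm z + norm c" by simp
    qed auto
    finally have Pb: "norm (\<Prod>i<l. z - c * q ^ i) \<le> (norm z + norm c) ^ l" by simp
    have eq: "gauss_term q (z * q ^ n) (c * q ^ n) l = (-1) ^ l * q ^ (l choose 2)
       * (\<Prod>i<l. z - c * q ^ i) * (q ^ n) ^ l * (rq q (int l) * (qfin c q n * inverse (qfin c q (n + l))))"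
      unfolding gauss_term_def P divide_inverse inv by (simp only: mult_ac)
    have "norm (gauss_term q (z * q ^ n) (c * q ^ n) l) = norm q ^ (l choose 2)
       * norm (\<Prod>i<l. z - c * q ^ i) * norm (q ^ n) ^ l * norm (rq q (int l) * (qfin c q n * inverse (qfin c q (n + l))))"
      unfolding eq by (simp add: norm_mult norm_power)
    also have "\<dots> \<le> norm q ^ (l choose 2) * (norm z + norm c) ^ l * norm (q ^ n) ^ l * (K1 * (K2 * K3))"
    proof (intro mult_mono Pb)
      have "norm (rq q (int l)) * (norm (qfin c q n) * norm (inverse (qfin c q (n + l)))) \<le> K1 * (K2 * K3)"
        using K1 K2 K3 by (intro mult_mono) (auto simp: less_imp_le)
      thus "norm (rq q (int l) * (qfin c q n * inverse (qfin c q (n + l)))) \<le> K1 * (K2 * K3)"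
        by (simp add: norm_mult)
    qed auto
    also have "\<dots> = K1 * (K2 * K3) * (norm q ^ (l choose 2) * (norm z + norm c) ^ l) * norm (q ^ n) ^ l"
      by (simp only: mult_ac)
    finally show "norm (gauss_term q (z * q ^ n) (c * q ^ n) l) \<le> \<dots>" .
  qed
qed

lemma summable_norm_gauss_term: "summable (\<lambda>l. norm (gauss_term q z c l))"
proof -
  obtain K where K: "K > 0" "\<And>n l. norm (gauss_term q (z * q ^ n) (c * q ^ n) l)
       \<le> K * (norm q ^ (l choose 2) * (norm z + norm c) ^ l) * norm (q ^ n) ^ l"
    using gauss_term_bound by auto
  show ?thesis
  proof (rule summable_comparison_test)
    show "\<exists>N. \<forall>l\<ge>N. norm (norm (gauss_term q z c l)) \<le> K * (norm q ^ (l choose 2) * (norm z + norm c) ^ l)"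
      using K(2)[of 0] by auto
    show "summable (\<lambda>l. K * (norm q ^ (l choose 2) * (norm z + norm c) ^ l))"
      using q by (intro summable_mult summable_qpow_choose) auto
  qed
qed

text \<open>A telescoping certificate for the passage from (z, c) to (zq, cq): the antidifference is
  (1 - q^l) times the term itself. It is 0 at l = 0 and tends to 0, so the differences sum to
  0.\<close>

lemma gauss_term_telescope:
  "gauss_term q z c l - (1 - z) / (1 - c) * gauss_term q (z * q) (c * q) l
    = (1 - q ^ l) * gauss_term q z c l - (1 - q ^ Suc l) * gauss_term q z c (Suc l)"
proof -
  define A where "A = (-1) ^ l * q ^ (l choose 2) * (\<Prod>i<l. z - c * q ^ i)"
  have nz: "1 - c \<noteq> 0" "1 - c * q ^ l \<noteq> 0" "qfin c q l \<noteq> 0" "qfin (c * q) q l \<noteq> 0"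
    using c[of 0] c[of l] c c[of "Suc _"] by (auto intro!: qfin_nonzero simp: mult_ac)
  have sh: "qfin (c * q) q l = qfin c q l * (1 - c * q ^ l) / (1 - c)"
    using qfin_Suc_shift[of c q l] nz unfolding qfin_Suc by (simp add: field_simps)
  have P: "(\<Prod>i<l. z * q - c * q * q ^ i) = q ^ l * (\<Prod>i<l. z - c * q ^ i)"
  proof -
    have "(\<Prod>i<l. z * q - c * q * q ^ i) = (\<Prod>i<l. q * (z - c * q ^ i))"
      by (intro prod.cong) (auto simp: algebra_simps)
    thus ?thesis by (simp add: prod.distrib)
  qed
  have ch: "Suc l choose 2 = l + (l choose 2)" by (simp add: numeral_2_eq_2)
  have t0: "gauss_term q z c l = A * rq q (int l) / qfin c q l"
    by (simp add: gauss_term_def A_def)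
  have t1: "(1 - z) / (1 - c) * gauss_term q (z * q) (c * q) l
      = (1 - z) * q ^ l * (A * rq q (int l) / qfin c q l) / (1 - c * q ^ l)"
  proof -
    have aux: "u / d * (p * X / (F * e / d)) = u * p * (X / F) / e" if "d \<noteq> 0" for u d p X F e :: complex
      using that by simp
    have "gauss_term q (z * q) (c * q) l = q ^ l * (A * rq q (int l)) / (qfin c q l * (1 - c * q ^ l) / (1 - c))"
      unfolding gauss_term_def P sh A_def by (simp only: mult_ac)
    thus ?thesis by (simp only: aux[OF nz(1)])
  qed
  have "rq q (int (Suc l)) * (1 - q ^ Suc l) = rq q (int l)"
    using rq_rec[OF q, of "int (Suc l)"] unfolding power_int_of_nat by simp
  hence t2: "(1 - q ^ Suc l) * gauss_term q z c (Suc l)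
      = - (q ^ l) * (z - c * q ^ l) * (A * rq q (int l) / qfin c q l) / (1 - c * q ^ l)"
    unfolding gauss_term_def ch prod.lessThan_Suc qfin_Suc
    by (simp add: A_def power_add divide_inverse mult_ac) (simp add: algebra_simps)?
  define T where "T = A * rq q (int l) / qfin c q l"
  show ?thesis unfolding t0 t1 t2 T_def[symmetric] using nz by (simp add: field_simps)
qed

lemma gauss_term_rec:
  "suminf (gauss_term q z c) = (1 - z) / (1 - c) * suminf (gauss_term q (z * q) (c * q))"
proof -
  have s1: "summable (gauss_term q z c)" using summable_norm_gauss_term by (rule summable_norm_cancel)
  obtain K where K: "K > 0" "\<And>n l. norm (gauss_term q (z * q ^ n) (c * q ^ n) l)
       \<le> K * (norm q ^ (l choose 2) * (norm z + norm c) ^ l) * norm (q ^ n) ^ l"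
    using gauss_term_bound by auto
  have s2: "summable (gauss_term q (z * q) (c * q))"
  proof (rule summable_comparison_test)
    show "\<exists>N. \<forall>l\<ge>N. norm (gauss_term q (z * q) (c * q) l)
        \<le> K * (norm q ^ (l choose 2) * ((norm z + norm c) * norm q) ^ l)"
      using K(2)[of 1] by (auto simp: power_mult_distrib mult_ac)
    show "summable (\<lambda>l. K * (norm q ^ (l choose 2) * ((norm z + norm c) * norm q) ^ l))"
      using q by (intro summable_mult summable_qpow_choose) auto
  qed
  have "(\<lambda>l. (1 - q ^ l) * gauss_term q z c l) \<longlonglongrightarrow> (1 - 0) * 0"
    using q s1 by (intro tendsto_intros LIMSEQ_power_zero summable_LIMSEQ_zero) auto
  from telescope_sums'[OF this]
  have "(\<lambda>l. gauss_term q z c l - (1 - z) / (1 - c) * gauss_term q (z * q) (c * q) l) sums 0"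
    unfolding gauss_term_telescope by simp
  hence "(\<Sum>l. gauss_term q z c l - (1 - z) / (1 - c) * gauss_term q (z * q) (c * q) l) = 0"
    by (rule sums_unique[symmetric])
  thus ?thesis
    unfolding suminf_diff[OF s1 summable_mult[OF s2], symmetric] suminf_mult[OF s2] by simp
qed

end

text \<open>Iterating the recurrence n times produces (z)_n/(c)_n. As n grows, every term with l > 0
  of the shifted series dies because of its factor (q^n)^l, so that series tends to 1.\<close>

lemma q_gauss_limit:
  fixes q z c :: complex
  assumes q: "norm q < 1" and c: "\<And>i. c * q ^ i \<noteq> 1"
  shows "gauss_term q z c sums (qpoch_inf z q / qpoch_inf c q)"
proof -
  have iter: "suminf (gauss_term q z c)
      = qfin z q n / qfin c q n * suminf (gauss_term q (z * q ^ n) (c * q ^ n))" for n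
  proof (induction n)
    case (Suc n)
    have "c * q ^ n * q ^ i \<noteq> 1" for i using c[of "n + i"] by (simp add: power_add mult_ac)
    from gauss_term_rec[OF q this, of "z * q ^ n"] Suc show ?case
      by (simp add: qfin_Suc mult_ac)
  qed simp
  obtain K where K: "K > 0" "\<And>n l. norm (gauss_term q (z * q ^ n) (c * q ^ n) l)
       \<le> K * (norm q ^ (l choose 2) * (norm z + norm c) ^ l) * norm (q ^ n) ^ l"
    using gauss_term_bound[OF q c, of z] by auto
  define M where "M l = K * (norm q ^ (l choose 2) * (norm z + norm c) ^ l)" for l
  have M0: "M l \<ge> 0" for l using K(1) by (simp add: M_def)
  have "((\<lambda>n. suminf (\<lambda>l. gauss_term q (z * q ^ n) (c * q ^ n) l)) \<longlongrightarrow> suminf (\<lambda>l. if l = 0 then 1 else 0)) at_top"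
  proof (rule tannerys_theorem[THEN conjunct2, THEN conjunct2])
    show "summable M" unfolding M_def using q by (intro summable_mult summable_qpow_choose) auto
    have "norm (gauss_term q (z * q ^ n) (c * q ^ n) l) \<le> M l" for l n
    proof -
      have "M l * norm (q ^ n) ^ l \<le> M l * 1"
        using q M0 by (intro mult_left_mono power_le_one) (auto simp: norm_power intro: power_le_one)
      thus ?thesis using K(2)[of n l] by (simp add: M_def)
    qed
    thus "\<forall>\<^sub>F (l, n) in at_top \<times>\<^sub>F at_top. norm (gauss_term q (z * q ^ n) (c * q ^ n) l) \<le> M l"
      by (simp add: case_prod_unfold)
    fix l
    show "(\<lambda>n. gauss_term q (z * q ^ n) (c * q ^ n) l) \<longlonglongrightarrow> (if l = 0 then 1 else 0)"
    proof (cases "l = 0")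
      case True
      thus ?thesis by (simp add: gauss_term_def binomial_eq_0)
    next
      case False
      have "(\<lambda>n. (norm q ^ l) ^ n) \<longlonglongrightarrow> 0"
        using norm_power_lt_1[of "norm q" l] False q by (intro LIMSEQ_realpow_zero) auto
      hence "(\<lambda>n. M l * (norm q ^ l) ^ n) \<longlonglongrightarrow> M l * 0" by (intro tendsto_mult tendsto_const)
      hence lim: "(\<lambda>n. M l * norm (q ^ n) ^ l) \<longlonglongrightarrow> 0"
        by (simp add: norm_power mult.commute flip: power_mult)
      have "(\<lambda>n. gauss_term q (z * q ^ n) (c * q ^ n) l) \<longlonglongrightarrow> 0"
        by (rule Lim_null_comparison[OF _ lim]) (use K(2) in \<open>auto simp: M_def\<close>)
      thus ?thesis using False by simp
    qed
  qed simp
  also have "suminf (\<lambda>l::nat. if l = 0 then 1 else 0 :: complex) = 1"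
    using sums_single[of 0 "\<lambda>_. 1 :: complex"] by (intro sums_unique[symmetric]) simp
  finally have lim: "(\<lambda>n. suminf (gauss_term q (z * q ^ n) (c * q ^ n))) \<longlonglongrightarrow> 1" .
  have "(\<lambda>n. qfin z q n / qfin c q n * suminf (gauss_term q (z * q ^ n) (c * q ^ n)))
      \<longlonglongrightarrow> qpoch_inf z q / qpoch_inf c q * 1"
    using c by (intro tendsto_intros qfin_tendsto q lim qpoch_inf_nonzero) auto
  hence "suminf (gauss_term q z c) = qpoch_inf z q / qpoch_inf c q"
    unfolding iter[symmetric] by (simp add: LIMSEQ_const_iff)
  thus ?thesis using summable_norm_cancel[OF summable_norm_gauss_term[OF q c]]
    by (metis summable_sums)
qed

section \<open>The Jacobi triple product\<close>

text \<open>The q-binomial theorem of length 2N in base g^2, recentred by t = N + n. With z = w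
  g^(1-2N) its factors are 1 - w g^k for the odd k from 1-2N to 2N-1, symmetric about 0.\<close>

lemma jacobi_triple_product_finite:
  fixes g w :: complex
  assumes g: "norm g < 1" "g \<noteq> 0" and w: "w \<noteq> 0"
  shows "(\<Sum>n\<in>{-int N..int N}. (-1) powi n * g powi (n\<^sup>2) * w powi n * (rq (g\<^sup>2) (int N + n) * rq (g\<^sup>2) (int N - n)))
    = rq (g\<^sup>2) (2 * int N) * qfin (g / w) (g\<^sup>2) N * qfin (g * w) (g\<^sup>2) N"
proof -
  define Q where "Q = g\<^sup>2"
  have Q: "norm Q < 1" "Q \<noteq> 0" using g norm_power_lt_1[of "norm g" 2] by (auto simp: Q_def norm_power)
  define z where "z = w * g powi (1 - 2 * int N)"
  \<comment> \<open>Produced by the recentring on one side. On the other it is what comes out of the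
    N factors with negative exponent, as 1 + 3 + ... + (2N-1) = N^2, so it cancels.\<close>
  define C where "C = (-1) ^ N * g powi (- (int N)\<^sup>2) * w ^ N"
  have C0: "C \<noteq> 0" using g w by (simp add: C_def)
  define f where "f n = (-1) powi n * g powi (n\<^sup>2) * w powi n" for n
  have tm: "(-1) ^ t * Q ^ (t choose 2) * z ^ t = C * f (int t - int N)" for t
  proof -
    have "(-1::complex) ^ t = (-1) ^ N * (-1) powi (int t - int N)"
      using powi_eq_mult[of "-1 :: complex" "int t" "int N" "int t - int N"] by simp
    moreover have "w ^ t = w ^ N * w powi (int t - int N)"
      using powi_eq_mult[of w "int t" "int N" "int t - int N"] w by simp
    moreover have "Q ^ (t choose 2) * (g powi (1 - 2 * int N)) ^ t
        = g powi (- (int N)\<^sup>2) * g powi ((int t - int N)\<^sup>2)"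
    proof -
      have ch: "int (2 * (t choose 2)) = int t * (int t - 1)" using two_choose_two[of t] by simp
      have "Q ^ (t choose 2) = g powi (int t * (int t - 1))"
        unfolding ch[symmetric] power_int_of_nat by (simp add: Q_def power_mult)
      moreover have "(g powi (1 - 2 * int N)) ^ t = g powi ((1 - 2 * int N) * int t)"
        by (simp add: power_int_power')
      ultimately show ?thesis unfolding \<open>Q ^ (t choose 2) = _\<close>
        using g by (simp add: power_int_add[symmetric] del: power_int_add) (simp add: algebra_simps power2_eq_square)
    qed
    ultimately show ?thesis by (simp add: C_def f_def z_def power_mult_distrib mult_ac)
  qed
  have "C * (\<Sum>n\<in>{-int N..int N}. f n * (rq Q (int N + n) * rq Q (int N - n)))
      = (\<Sum>t\<le>2*N. C * f (int t - int N) * rq Q (int t) * rq Q (int (2 * N) - int t))"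
    unfolding sum_distrib_left
    by (intro sum.reindex_bij_witness[of _ "\<lambda>t. int t - int N" "\<lambda>n. nat (n + int N)"])
       (auto simp: algebra_simps)
  also have "\<dots> = rq Q (int (2 * N)) * qfin z Q (2 * N)"
    unfolding tm[symmetric] by (rule q_binomial[OF Q])
  also have "qfin z Q (2 * N) = qfin z Q N * qfin (z * Q ^ N) Q N"
    using qfin_add[of z Q N N] by (simp add: mult_2)
  also have "z * Q ^ N = g * w"
  proof -
    have "Q ^ N = g powi (2 * int N)"
      unfolding Q_def using power_int_of_nat[of g "2 * N"] by (simp add: power_mult)
    moreover have "g = g powi (1 - 2 * int N) * g powi (2 * int N)"
      using powi_eq_mult[OF g(2), of 1] by simp
    ultimately show ?thesis by (simp add: z_def mult_ac)
  qed
  also have "qfin z Q N = C * qfin (g / w) Q N"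
  proof -
    have "qfin z Q N = (\<Prod>i<N. 1 - w * g powi (- (2 * int (N - Suc i) + 1)))"
      unfolding qfin_def
    proof (intro prod.cong refl)
      fix i assume "i \<in> {..<N}"
      hence 1: "Q ^ i = g powi (2 * int i)" and 2: "- (2 * int (N - Suc i) + 1) = (1 - 2 * int N) + 2 * int i"
        unfolding Q_def using power_int_of_nat[of g "2 * i"] by (auto simp: power_mult of_nat_diff)
      show "1 - z * Q ^ i = 1 - w * g powi (- (2 * int (N - Suc i) + 1))"
        unfolding z_def 1 powi_eq_mult[OF g(2) 2] by (simp only: mult_ac)
    qed
    also have "\<dots> = (\<Prod>k<N. 1 - w * g powi (- (2 * int k + 1)))"
      by (rule prod.nat_diff_reindex)
    also have "\<dots> = (\<Prod>k<N. - w * g powi (- (2 * int k + 1)) * (1 - g / w * Q ^ k))"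
    proof (intro prod.cong refl)
      fix k
      have "Q ^ k = g powi (2 * int k)"
        unfolding Q_def using power_int_of_nat[of g "2 * k"] by (auto simp: power_mult)
      hence "g * Q ^ k = g powi (2 * int k + 1)" using g by (simp add: power_int_add)
      hence "g powi (- (2 * int k + 1)) * (g * Q ^ k) = 1"
        using powi_eq_mult[OF g(2), of 0 "- (2 * int k + 1)" "2 * int k + 1"] by simp
      thus "1 - w * g powi (- (2 * int k + 1)) = - w * g powi (- (2 * int k + 1)) * (1 - g / w * Q ^ k)"
        using w by (simp add: field_simps)
    qed
    also have "\<dots> = (\<Prod>k<N. - w * g powi (- (2 * int k + 1))) * qfin (g / w) Q N"
      by (simp only: prod.distrib qfin_def)
    also have "(\<Prod>k<N. - w * g powi (- (2 * int k + 1))) = C"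
      unfolding C_def
    proof (induction N)
      case (Suc N)
      have "g powi (- (int (Suc N))\<^sup>2) = g powi (- (int N)\<^sup>2) * g powi (- (2 * int N + 1))"
        by (rule powi_eq_mult) (use g in \<open>auto simp: power2_eq_square algebra_simps\<close>)
      thus ?case unfolding prod.lessThan_Suc Suc.IH by (simp only: power_Suc) simp
    qed simp
    finally show ?thesis .
  qed
  finally have "C * (\<Sum>n\<in>{-int N..int N}. f n * (rq Q (int N + n) * rq Q (int N - n)))
      = C * (rq Q (2 * int N) * qfin (g / w) Q N * qfin (g * w) Q N)" by (simp add: mult_ac)
  thus ?thesis using C0 by (simp add: Q_def f_def)
qed

lemma summable_theta:
  fixes g w :: complex
  assumes g: "norm g < 1" "g \<noteq> 0" and w: "w \<noteq> 0"
  shows "(\<lambda>n::int. norm ((-1) powi n * g powi (n\<^sup>2) * w powi n)) summable_on UNIV"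
proof -
  define \<rho> where "\<rho> = norm g"
  have \<rho>: "0 < \<rho>" "\<rho> < 1" using g by (auto simp: \<rho>_def)
  \<comment> \<open>With |g|^a below both |w| and 1/|w|, |w^n| <= |g|^(-a|n|) for either sign of n:
    a linear exponent, which n^2 beats.\<close>
  obtain a :: nat where a: "\<rho> ^ a < min (norm w) (inverse (norm w))"
    using real_arch_pow_inv[of "min (norm w) (inverse (norm w))" \<rho>] w \<rho> by auto
  have wb: "norm (w powi n) \<le> \<rho> powi (- int a * \<bar>n\<bar>)" for n
  proof -
    have "norm w \<le> inverse (\<rho> ^ a)" "inverse (norm w) \<le> inverse (\<rho> ^ a)"
      using a w \<rho> le_imp_inverse_le[of "\<rho> ^ a" "inverse (norm w)"]
      by (auto simp: less_imp_le intro!: le_imp_inverse_le)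
    hence 1: "norm w ^ k \<le> inverse (\<rho> ^ a) ^ k" "inverse (norm w) ^ k \<le> inverse (\<rho> ^ a) ^ k" for k
      by (auto intro: power_mono)
    have "norm (w powi n) \<le> inverse (\<rho> ^ a) ^ nat \<bar>n\<bar>"
    proof (cases "n \<ge> 0")
      case True thus ?thesis using 1(1)[of "nat n"] by (simp add: norm_power power_int_nonneg_exp)
    next
      case False
      thus ?thesis using 1(2)[of "nat (-n)"] by (simp add: power_int_def norm_power norm_inverse power_inverse)
    qed
    also have "\<dots> = \<rho> powi (- int a * \<bar>n\<bar>)"
      by (simp add: power_int_mult power_int_minus power_int_nonneg_exp power_inverse)
    finally show ?thesis .
  qed
  define c where "c = (int a + 1)\<^sup>2"
  have "norm ((-1) powi n * g powi (n\<^sup>2) * w powi n) \<le> \<rho> powi (- c) * \<rho> ^ nat \<bar>n\<bar>" for n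
  proof -
    have "norm ((-1) powi n * g powi (n\<^sup>2) * w powi n) \<le> norm (g powi (n\<^sup>2)) * \<rho> powi (- int a * \<bar>n\<bar>)"
      unfolding norm_mult using wb by (simp add: norm_power_int mult_left_mono)
    also have "\<dots> = \<rho> powi (n\<^sup>2 + - int a * \<bar>n\<bar>)"
      unfolding norm_power_int \<rho>_def using g by (intro powi_eq_mult[symmetric]) auto
    also have "\<dots> = norm (g powi (n\<^sup>2 + - int a * \<bar>n\<bar>))" by (simp add: norm_power_int \<rho>_def)
    also have "\<dots> \<le> \<rho> powi (- c) * \<rho> ^ nat \<bar>\<bar>n\<bar>\<bar>"
      unfolding \<rho>_def c_def using quadratic_ge_abs[of 1 "- int a" "int a" "\<bar>n\<bar>"]
      by (intro norm_powi_le g) simp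
    finally show ?thesis by simp
  qed
  thus ?thesis using \<rho>
    by (intro Infinite_Sum.abs_summable_on_comparison_test'[where g = "\<lambda>n. \<rho> powi (- c) * \<rho> ^ nat \<bar>n\<bar>"])
       (auto intro!: summable_on_cmult_right summable_geometric_int)
qed

text \<open>The limit of the finite form: its two weights are bounded and each tends to
  1/(g^2;g^2)_inf, so dominated convergence applies. Tannery's theorem speaks of series over the
  naturals, hence the enumeration of the integers by \<open>int_decode\<close>.\<close>

theorem jacobi_triple_product:
  fixes g w :: complex
  assumes g: "norm g < 1" "g \<noteq> 0" and w: "w \<noteq> 0"
  shows "((\<lambda>n::int. (-1) powi n * g powi (n\<^sup>2) * w powi n)
    has_sum qpochs_inf [g\<^sup>2, g * w, g / w] (g\<^sup>2)) UNIV"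
proof -
  define Q where "Q = g\<^sup>2"
  have Q: "norm Q < 1" "Q \<noteq> 0" using g norm_power_lt_1[of "norm g" 2] by (auto simp: Q_def norm_power)
  define f where "f n = (-1) powi n * g powi (n\<^sup>2) * w powi n" for n
  define I where "I = inverse (qpoch_inf Q Q)"
  have I0: "I \<noteq> 0" using qpoch_inf_q_nonzero[OF Q(1)] by (simp add: I_def)
  have fs: "(\<lambda>n. norm (f n)) summable_on UNIV" unfolding f_def by (rule summable_theta[OF assms])
  have bij: "bij_betw int_decode UNIV UNIV" by (rule bij_int_decode)
  have fs': "summable (\<lambda>k. norm (f (int_decode k)))"
  proof -
    have "(\<lambda>k. norm (f (int_decode k))) summable_on UNIV"
      using summable_on_reindex_bij_betw[OF bij, of "\<lambda>n. norm (f n)"] fs by simp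
    thus ?thesis using summable_on_imp_summable by blast
  qed
  obtain K where K: "K > 0" "\<And>k. norm (rq Q k) \<le> K" using rq_bounded[OF Q(1)] by metis
  have sums_sym: "(\<Sum>k. F (int_decode k)) = s" if "(F has_sum s) UNIV" for F :: "int \<Rightarrow> complex" and s
  proof -
    have "((\<lambda>k. F (int_decode k)) has_sum s) UNIV" using has_sum_reindex_bij_betw[OF bij, of F s] that by simp
    thus ?thesis using has_sum_imp_sums sums_unique by metis
  qed
  define a where "a k N = f (int_decode k) * (rq Q (int N + int_decode k) * rq Q (int N - int_decode k))" for k N
  have "((\<lambda>N. suminf (\<lambda>k. a k N)) \<longlongrightarrow> suminf (\<lambda>k. f (int_decode k) * (I * I))) at_top"
  proof (rule tannerys_theorem[THEN conjunct2, THEN conjunct2])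
    show "summable (\<lambda>k. norm (f (int_decode k)) * (K * K))" by (intro summable_mult2 fs')
    have "norm (a k N) \<le> norm (f (int_decode k)) * (K * K)" for k N
      unfolding a_def norm_mult using K by (intro mult_left_mono mult_mono) (auto simp: less_imp_le)
    thus "\<forall>\<^sub>F (k, N) in at_top \<times>\<^sub>F at_top. norm (a k N) \<le> norm (f (int_decode k)) * (K * K)"
      by (simp add: case_prod_unfold)
    fix k
    show "(\<lambda>N. a k N) \<longlonglongrightarrow> f (int_decode k) * (I * I)"
      unfolding a_def I_def using rq_tendsto[OF Q(1), of "int_decode k"] rq_tendsto[OF Q(1), of "- int_decode k"]
      by (intro tendsto_intros) auto
  qed simp
  moreover have "suminf (\<lambda>k. a k N) = rq Q (2 * int N) * qfin (g / w) Q N * qfin (g * w) Q N" for N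
  proof -
    have "((\<lambda>n. f n * (rq Q (int N + n) * rq Q (int N - n))) has_sum
       (rq Q (2 * int N) * qfin (g / w) Q N * qfin (g * w) Q N)) UNIV"
      using jacobi_triple_product_finite[OF assms, of N]
      by (intro has_sum_finite_neutralI[of "{-int N..int N}"]) (auto simp: f_def Q_def)
    thus ?thesis unfolding a_def by (rule sums_sym)
  qed
  moreover have "(\<lambda>N. rq Q (2 * int N) * qfin (g / w) Q N * qfin (g * w) Q N)
      \<longlonglongrightarrow> I * qpoch_inf (g / w) Q * qpoch_inf (g * w) Q"
  proof (intro tendsto_intros qfin_tendsto Q)
    have "filterlim (\<lambda>N::nat. 2 * N) at_top at_top"
      by (intro filterlim_subseq strict_monoI) auto
    from filterlim_compose[OF rq_tendsto[OF Q(1), of 0] this]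
    show "(\<lambda>N. rq Q (2 * int N)) \<longlonglongrightarrow> I" by (simp add: I_def)
  qed
  ultimately have eq: "suminf (\<lambda>k. f (int_decode k) * (I * I)) = I * qpoch_inf (g / w) Q * qpoch_inf (g * w) Q"
    using LIMSEQ_unique by auto
  obtain s where s: "(f has_sum s) UNIV"
    using abs_summable_summable[OF fs] by (auto simp: summable_on_def)
  have "((\<lambda>n. f n * (I * I)) has_sum (s * (I * I))) UNIV" by (intro has_sum_cmult_left s)
  from sums_sym[OF this] eq have "s * (I * I) = I * qpoch_inf (g / w) Q * qpoch_inf (g * w) Q" by (simp only:)
  hence "s = qpoch_inf Q Q * qpoch_inf (g * w) Q * qpoch_inf (g / w) Q"
    using I0 by (simp add: I_def field_simps)
  thus ?thesis using s by (simp add: f_def[abs_def] qpochs_inf_def Q_def mult_ac)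
qed

section \<open>Bailey steps\<close>

text \<open>The Bailey kernel 1/((q)_(n-j) (aq)_(n+j)) relative to a = q^m, divided by (q)_m. In
  this normalisation j -> -m-j merely exchanges the two factors.\<close>

definition bU :: "complex \<Rightarrow> nat \<Rightarrow> int \<Rightarrow> int \<Rightarrow> complex" where
  "bU q m n j = rq q (n - j) * rq q (int m + n + j)"

lemma bU_reflect: "bU q m n (- int m - j) = bU q m n j"
proof -
  have "n - (- int m - j) = int m + n + j" "int m + n + (- int m - j) = n - j" by simp_all
  thus ?thesis unfolding bU_def by (simp only: mult.commute)
qed

lemma bU_eq_0: "n < j \<or> int m + n + j < 0 \<Longrightarrow> bU q m n j = 0"
  by (auto simp: bU_def)

text \<open>The lower limit is harmless: a nonzero term needs k >= j and k >= -m-j, and adding these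
  gives 2k >= -m. The substitution k = j + l then yields a q-Vandermonde sum with N = n - j and M =
  m + 2j.\<close>

lemma sum_bU:
  assumes "j \<le> n"
  shows "(\<Sum>k\<in>{- int (m div 2)..n}. f k * rq q (n - k) * bU q m k j)
    = (\<Sum>l\<le>nat (n - j). f (j + int l) * rq q (int (nat (n - j)) - int l) * rq q (int l)
         * rq q (int m + 2 * j + int l))"
proof -
  have "(\<Sum>k\<in>{- int (m div 2)..n}. f k * rq q (n - k) * bU q m k j)
      = (\<Sum>k\<in>{j..n}. f k * rq q (n - k) * bU q m k j)"
  proof (rule sum.mono_neutral_cong)
    fix k assume "k \<in> {j..n} - {- int (m div 2)..n}"
    hence "int m + k + j < 0" by auto
    thus "f k * rq q (n - k) * bU q m k j = 0" by (simp add: bU_eq_0)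
  next
    fix k assume "k \<in> {- int (m div 2)..n} - {j..n}"
    thus "f k * rq q (n - k) * bU q m k j = 0" by (auto simp: bU_eq_0)
  qed auto
  also have "\<dots> = (\<Sum>l\<le>nat (n - j). f (j + int l) * rq q (int (nat (n - j)) - int l) * rq q (int l)
         * rq q (int m + 2 * j + int l))"
    using assms
    by (intro sum.reindex_bij_witness[of _ "\<lambda>l. j + int l" "\<lambda>k. nat (k - j)"])
       (auto simp: bU_def algebra_simps)
  finally show ?thesis .
qed

lemma sum_bU_eq_0:
  assumes "n < j"
  shows "(\<Sum>k\<in>{- int (m div 2)..n}. f k * rq q (n - k) * bU q m k j) = 0"
  using assms by (intro sum.neutral) (auto simp: bU_eq_0)

text \<open>Under k = j + l the exponent splits as k^2 + mk = (j^2 + mj) + l (l + m + 2j), which is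
  the exponent of \<open>q_vandermonde\<close>.\<close>

lemma bailey_step:
  assumes q: "norm q < 1" "q \<noteq> 0"
  shows "(\<Sum>k\<in>{- int (m div 2)..n}. q powi (k\<^sup>2 + int m * k) * rq q (n - k) * bU q m k j)
    = q powi (j\<^sup>2 + int m * j) * bU q m n j"
proof (cases "j \<le> n")
  case True
  define N where "N = nat (n - j)"
  have N: "int N = n - j" using True by (simp add: N_def)
  have e: "q powi ((j + int l)\<^sup>2 + int m * (j + int l))
      = q powi (j\<^sup>2 + int m * j) * q powi (int l * (int l + (int m + 2 * j)))" for l
    by (rule powi_eq_mult) (use q in \<open>auto simp: algebra_simps power2_eq_square\<close>)
  have "(\<Sum>k\<in>{- int (m div 2)..n}. q powi (k\<^sup>2 + int m * k) * rq q (n - k) * bU q m k j)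
     = q powi (j\<^sup>2 + int m * j) *
       (\<Sum>l\<le>N. q powi (int l * (int l + (int m + 2 * j))) * rq q (int N - int l) * rq q (int l)
         * rq q (int m + 2 * j + int l))"
    unfolding sum_bU[OF True] e N_def[symmetric] sum_distrib_left by (simp only: mult_ac)
  also have "\<dots> = q powi (j\<^sup>2 + int m * j) * bU q m n j"
    unfolding q_vandermonde[OF q] by (simp add: N bU_def algebra_simps)
  finally show ?thesis .
qed (simp add: sum_bU_eq_0 bU_eq_0)

text \<open>This is the weight of an index among s_2, ..., s_i. Unlike in
  \<open>bailey_step\<close>, the new factor involves the outer index n, so the result is not the
  kernel times a function of j.\<close>

lemma bailey_step_lower:
  assumes q: "norm q < 1" "q \<noteq> 0"
  shows "(\<Sum>k\<in>{- int (m div 2)..n}. q powi (k\<^sup>2 + (int m - 1) * k) * rq q (n - k) * bU q m k j)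
    = q powi (j\<^sup>2 + (int m - 1) * j) * (1 + q powi (int m + 2 * j) - q powi (int m + n + j)) * bU q m n j"
proof (cases "j \<le> n")
  case True
  define N where "N = nat (n - j)"
  have N: "int N = n - j" using True by (simp add: N_def)
  have e: "q powi ((j + int l)\<^sup>2 + (int m - 1) * (j + int l))
      = q powi (j\<^sup>2 + (int m - 1) * j) * q powi (int l * (int l + (int m + 2 * j)) - int l)" for l
    by (rule powi_eq_mult) (use q in \<open>auto simp: algebra_simps power2_eq_square\<close>)
  have "(\<Sum>k\<in>{- int (m div 2)..n}. q powi (k\<^sup>2 + (int m - 1) * k) * rq q (n - k) * bU q m k j)
     = q powi (j\<^sup>2 + (int m - 1) * j) *
       (\<Sum>l\<le>N. q powi (int l * (int l + (int m + 2 * j)) - int l) * rq q (int N - int l) * rq q (int l)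
         * rq q (int m + 2 * j + int l))"
    unfolding sum_bU[OF True] e N_def[symmetric] sum_distrib_left by (simp only: mult_ac)
  also have "\<dots> = q powi (j\<^sup>2 + (int m - 1) * j) * ((1 + q powi (int m + 2 * j) - q powi (int m + n + j)) * bU q m n j)"
    unfolding q_vandermonde_shifted[OF q] by (simp add: N bU_def algebra_simps)
  finally show ?thesis by (simp only: mult_ac)
qed (simp add: sum_bU_eq_0 bU_eq_0)

text \<open>The kernel after i lowered steps. With y = q^(m+2j) and e = q^(m+n+j) the middle factor
  is ((1 - y^(i+1)) - e (1 - y^i))/(1 - y), written out so that y = 1 is allowed.\<close>

definition bG :: "complex \<Rightarrow> nat \<Rightarrow> nat \<Rightarrow> int \<Rightarrow> int \<Rightarrow> complex" where
  "bG q m i n j = q powi (int i * (j\<^sup>2 + (int m - 1) * j))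
     * ((\<Sum>k\<le>i. (q powi (int m + 2 * j)) ^ k) - q powi (int m + n + j) * (\<Sum>k<i. (q powi (int m + 2 * j)) ^ k))
     * bU q m n j"

lemma bG_0: "bG q m 0 n j = bU q m n j"
  by (simp add: bG_def)

text \<open>Since q^((m-1)k) q^(m+k+j) = q^(m+j) q^(mk), the part of the inner kernel with q^(m+k+j)
  is summed by \<open>bailey_step\<close> and the rest by \<open>bailey_step_lower\<close>. With P
  and R the two geometric sums in y, P (1 + y - e) - y R = P + y^(i+1) - e P, which is the pattern
  for i + 1.\<close>

lemma bG_step:
  assumes q: "norm q < 1" "q \<noteq> 0"
  shows "(\<Sum>k\<in>{- int (m div 2)..n}. q powi (k\<^sup>2 + (int m - 1) * k) * rq q (n - k) * bG q m i k j)
    = bG q m (Suc i) n j"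
proof -
  define y where "y = q powi (int m + 2 * j)"
  define e where "e = q powi (int m + n + j)"
  define V where "V = q powi (j\<^sup>2 + (int m - 1) * j)"
  define W where "W = q powi (int i * (j\<^sup>2 + (int m - 1) * j))"
  define P where "P = (\<Sum>k\<le>i. y ^ k)"
  define R where "R = (\<Sum>k<i. y ^ k)"
  have PR: "P = R + y ^ i" unfolding P_def R_def by (simp add: lessThan_Suc_atMost[symmetric])
  have PR': "P = 1 + y * R" unfolding P_def R_def lessThan_Suc_atMost[symmetric]
    by (subst sum.lessThan_Suc_shift) (simp add: sum_distrib_left)
  have P': "(\<Sum>k\<le>Suc i. y ^ k) = P + y ^ Suc i" "(\<Sum>k<Suc i. y ^ k) = P"
    unfolding P_def by (simp_all add: lessThan_Suc_atMost)
  have W': "q powi (int (Suc i) * (j\<^sup>2 + (int m - 1) * j)) = V * W"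
    unfolding V_def W_def by (rule powi_eq_mult) (use q in \<open>auto simp: algebra_simps\<close>)
  have tm: "q powi (k\<^sup>2 + (int m - 1) * k) * rq q (n - k) * bG q m i k j
      = W * P * (q powi (k\<^sup>2 + (int m - 1) * k) * rq q (n - k) * bU q m k j)
      - W * q powi (int m + j) * R * (q powi (k\<^sup>2 + int m * k) * rq q (n - k) * bU q m k j)" for k
  proof -
    have "q powi (k\<^sup>2 + (int m - 1) * k) * q powi (int m + k + j) = q powi (int m + j) * q powi (k\<^sup>2 + int m * k)"
      unfolding power_int_add[symmetric, OF disjI1[OF q(2)]]
      by (rule arg_cong[where f = "power_int q"]) (simp add: algebra_simps)
    thus ?thesis unfolding bG_def y_def[symmetric] P_def[symmetric] R_def[symmetric] W_def[symmetric]
      by (simp add: algebra_simps)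
  qed
  have Vy: "q powi (int m + j) * q powi (j\<^sup>2 + int m * j) = V * y"
    unfolding V_def y_def power_int_add[symmetric, OF disjI1[OF q(2)]]
    by (rule arg_cong[where f = "power_int q"]) (simp add: algebra_simps)
  have "(\<Sum>k\<in>{- int (m div 2)..n}. q powi (k\<^sup>2 + (int m - 1) * k) * rq q (n - k) * bG q m i k j)
     = W * P * (V * (1 + y - e) * bU q m n j) - W * R * (q powi (int m + j) * q powi (j\<^sup>2 + int m * j)) * bU q m n j"
    unfolding tm sum_subtractf sum_distrib_left[symmetric] bailey_step[OF q] bailey_step_lower[OF q]
      V_def y_def e_def by (simp add: algebra_simps)
  also have "\<dots> = V * W * (P + y * (P - R) - e * P) * bU q m n j"
    unfolding Vy by (simp add: algebra_simps)
  also have "y * (P - R) = y ^ Suc i" unfolding PR by simp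
  finally show ?thesis
    unfolding bG_def y_def[symmetric] e_def[symmetric] W' P' by (simp add: algebra_simps)
qed

section \<open>The Bailey pair behind the sum over s_r\<close>

lemma qpoch_q_nat:
  assumes "norm q < 1" "k \<ge> 0"
  shows "qpoch q q k = qfin q q (nat k)"
proof -
  have "q * q ^ nat k * q ^ i \<noteq> 1" for i
    using q_power_neq_1[OF assms(1), of "Suc (nat k + i)"] by (simp add: power_add mult_ac)
  hence "qpoch_inf (q * q ^ nat k) q \<noteq> 0" using assms by (intro qpoch_inf_nonzero) auto
  thus ?thesis
    using qpoch_inf_split[OF assms(1), of q "nat k"] assms(2)
    by (simp add: qpoch_def power_int_nonneg_exp)
qed

lemma inverse_qpoch_q:
  assumes "norm q < 1" "k \<ge> 0"
  shows "inverse (qpoch q q k) = rq q k"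
  using assms by (simp add: qpoch_q_nat rq_def)

definition balpha :: "complex \<Rightarrow> int \<Rightarrow> complex" where
  "balpha q j = (-1) powi j * q powi (j * (j - 1) div 2)"

text \<open>Counted down from n, the pair becomes the summand of the q-binomial theorem with z =
  q^(1-n).\<close>

lemma balpha_diff:
  assumes q: "q \<noteq> 0"
  shows "balpha q (n - int t) = balpha q n * ((-1) ^ t * q ^ (t choose 2) * (q powi (1 - n)) ^ t)"
proof -
  have "even (n * (n - 1))" "even (int t * (int t - 1))" by auto
  then obtain a b where a: "n * (n - 1) = 2 * a" and b: "int t * (int t - 1) = 2 * b"
    by (meson evenE)
  have "int (t choose 2) = b" using two_choose_two[of t] b by simp
  moreover have "(n - int t) * (n - int t - 1) = 2 * (a + b + (1 - n) * int t)"
  proof -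
    have "(n - int t) * (n - int t - 1) = n * (n - 1) + int t * (int t - 1) + 2 * ((1 - n) * int t)"
      by (simp add: algebra_simps)
    thus ?thesis unfolding a b by simp
  qed
  ultimately have "q powi ((n - int t) * (n - int t - 1) div 2) = q powi (n * (n - 1) div 2) * q ^ (t choose 2) * (q powi (1 - n)) ^ t"
    using q a by (simp add: power_int_add power_int_mult flip: power_int_of_nat)
  moreover have "(-1::complex) powi (n - int t) = (-1) powi n * (-1) ^ t"
    by (simp add: power_int_diff field_simps flip: power_mult_distrib)
  ultimately show ?thesis by (simp add: balpha_def mult_ac)
qed

text \<open>With j = n - t the right side is alpha_n (q^(1-n))_N/(q)_N, where N = m + 2n. For n > 0
  the factor of index n - 1 is zero, and so is the q-binomial coefficient, whose lower entry exceeds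
  the upper. For n = -a <= 0 the quotient is (q)_(a+N)/((q)_a (q)_N).\<close>

lemma bailey_pair_finite:
  assumes q: "norm q < 1" "q \<noteq> 0" and n: "- int (m div 2) \<le> n"
  shows "(-1) powi n * q powi (n * (n - 1) div 2) * qbinom q (int m + n) (int m + 2 * n)
    = (\<Sum>j\<in>{- int m - n..n}. balpha q j * bU q m n j)"
proof -
  define N where "N = nat (int m + 2 * n)"
  have N: "int N = int m + 2 * n" using n by (simp add: N_def)
  have "(\<Sum>j\<in>{- int m - n..n}. balpha q j * bU q m n j)
      = (\<Sum>t\<le>N. balpha q (n - int t) * (rq q (int t) * rq q (int N - int t)))"
    using N
    by (intro sum.reindex_bij_witness[of _ "\<lambda>t. n - int t" "\<lambda>j. nat (n - j)"])
       (auto simp: bU_def algebra_simps)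
  also have "\<dots> = balpha q n * (\<Sum>t\<le>N. (-1) ^ t * q ^ (t choose 2) * (q powi (1 - n)) ^ t * rq q (int t) * rq q (int N - int t))"
    unfolding balpha_diff[OF q(2)] sum_distrib_left by (simp only: mult_ac)
  also have "\<dots> = balpha q n * (rq q (int N) * qfin (q powi (1 - n)) q N)"
    unfolding q_binomial[OF q] ..
  also have "rq q (int N) * qfin (q powi (1 - n)) q N = qbinom q (int m + n) (int m + 2 * n)"
  proof (cases "n > 0")
    case True
    have "q powi (1 - n) * q ^ nat (n - 1) = 1"
      using True q by (simp add: power_int_diff flip: power_int_of_nat)
    moreover have "nat (n - 1) < N" using True N by linarith
    ultimately have "qfin (q powi (1 - n)) q N = 0" unfolding qfin_def
      by (intro prod_zero) (auto intro!: bexI[of _ "nat (n - 1)"])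
    thus ?thesis using True by (simp add: qbinom_def)
  next
    case False
    define a where "a = nat (- n)"
    have a: "n = - int a" using False by (simp add: a_def)
    have aN: "int m + n = int (a + N)" using N a by simp
    have "q powi (1 - n) = q * q ^ a" using q by (simp add: a power_int_add)
    moreover have "qfin q q (a + N) = qfin q q a * qfin (q * q ^ a) q N" by (rule qfin_add)
    moreover have "qbinom q (int m + n) (int m + 2 * n) = qfin q q (a + N) / (qfin q q N * qfin q q a)"
    proof -
      have p: "qpoch q q (int k) = qfin q q k" for k using qpoch_q_nat[OF q(1), of "int k"] by simp
      have d: "int (a + N) - int N = int a" and c: "0 \<le> int N \<and> int N \<le> int (a + N)" by simp_all
      show ?thesis unfolding qbinom_def N[symmetric] aN if_P[OF c] d p ..
    qed
    ultimately show ?thesis using qfin_q_nonzero[OF q(1)] by (simp add: rq_nat field_simps)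
  qed
  finally show ?thesis by (simp add: balpha_def)
qed

lemma qpoch_add:
  assumes q: "norm q < 1" "q \<noteq> 0" and y: "\<And>i. y * q powi k * q ^ i \<noteq> 1"
  shows "qpoch y q (k + int l) = qpoch y q k * qfin (y * q powi k) q l"
proof -
  have e: "y * q powi (k + int l) = y * q powi k * q ^ l"
    using powi_eq_mult[OF q(2), of "k + int l" k "int l"] by simp
  have "qfin (y * q powi k) q l \<noteq> 0" by (rule qfin_nonzero) (rule y)
  thus ?thesis unfolding qpoch_def e
    using qpoch_inf_split[OF q(1), of "y * q powi k" l] by simp
qed

section \<open>The outermost summation\<close>

locale half_base =
  fixes h q :: complex
  assumes hq: "h\<^sup>2 = q" and q: "norm q < 1" "q \<noteq> 0"
begin

lemma h_nz: "h \<noteq> 0" using hq q by auto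

lemma norm_h: "norm h < 1"
proof (rule ccontr)
  assume "\<not> norm h < 1"
  hence "1 \<le> norm h ^ 2" by (intro one_le_power) auto
  also have "norm h ^ 2 = norm q" using hq by (metis norm_power)
  finally show False using q by simp
qed

lemma q_powi: "q powi k = h powi (2 * k)"
  unfolding hq[symmetric] by (simp add: power_int_mult)

lemma q_pow: "q ^ k = h ^ (2 * k)"
  unfolding hq[symmetric] by (simp add: power_mult)

lemma h_powi_nonneg: "M \<ge> 0 \<Longrightarrow> norm (- (h powi M)) < 1 \<or> - (h powi M) = -1"
  using norm_q_powi_lt_1[OF norm_h h_nz, of M] by (cases "M = 0") auto

text \<open>|h^M| = 1 only for M = 0, where the value is 2. So the denominators 1 + x never
  vanish.\<close>

lemma one_plus_h_powi_nz: "1 + h powi M \<noteq> 0"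
proof
  assume "1 + h powi M = 0"
  hence e: "h powi M = -1" by (simp add: add_eq_0_iff)
  hence "norm (h powi M) = 1" "norm (h powi (-M)) = 1" by (simp_all add: power_int_minus)
  hence "M = 0" using norm_q_powi_lt_1[OF norm_h h_nz, of M] norm_q_powi_lt_1[OF norm_h h_nz, of "-M"]
    by (cases "M > 0"; cases "M < 0") auto
  thus False using e by simp
qed

text \<open>The limiting q-Gauss sum with c = q^(M+1), z = -h^b and c/z = -h^a, divided by (q)_M so
  that 1/(c)_l becomes 1/(q)_(M+l). It serves for a = M, b = M + 2 and, with M + 1 for M, for a = b
  = M + 2.\<close>

lemma q_gauss_half:
  assumes "a + b = 2 * Suc M"
  shows "(\<lambda>l. h ^ (2 * (l choose 2) + b * l) * qfin (- (h ^ a)) q l * rq q (int l) * rq q (int M + int l))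
    sums (qpoch_inf (- (h ^ b)) q / qpoch_inf q q)"
proof -
  define c where "c = q * q ^ M"
  define z where "z = - (h ^ b)"
  have cz: "c = - (h ^ a) * z"
  proof -
    have "c = h ^ (2 * Suc M)" unfolding c_def using q_pow[of "Suc M"] by simp
    also have "\<dots> = h ^ a * h ^ b" unfolding assms[symmetric] by (rule power_add)
    finally show ?thesis by (simp add: z_def)
  qed
  have c1: "c * q ^ i \<noteq> 1" for i
    using q_power_neq_1[OF q(1), of "Suc (M + i)"] by (simp add: c_def power_add mult_ac)
  have nz: "qfin q q M \<noteq> 0" "qfin c q l \<noteq> 0" for l
    using qfin_q_nonzero[OF q(1)] qfin_nonzero[OF c1] by auto
  have tm: "gauss_term q z c l = qfin q q M *
    (h ^ (2 * (l choose 2) + b * l) * qfin (- (h ^ a)) q l * rq q (int l) * rq q (int M + int l))" for l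
  proof -
    have "(\<Prod>i<l. z - c * q ^ i) = (\<Prod>i<l. z * (1 - (- (h ^ a)) * q ^ i))"
      unfolding cz by (intro prod.cong refl) (simp add: algebra_simps)
    also have "\<dots> = z ^ l * qfin (- (h ^ a)) q l" unfolding prod.distrib qfin_def by simp
    also have "z ^ l = (-1) ^ l * h ^ (b * l)"
      unfolding z_def by (subst power_minus) (simp add: power_mult)
    finally have P: "(-1) ^ l * (\<Prod>i<l. z - c * q ^ i) = h ^ (b * l) * qfin (- (h ^ a)) q l"
      by (simp flip: power_mult_distrib)
    have "rq q (int M + int l) = inverse (qfin q q (M + l))" using rq_nat[of q "M + l"] by simp
    hence R: "inverse (qfin c q l) = qfin q q M * rq q (int M + int l)"
      using nz unfolding c_def qfin_add by simp
    have "gauss_term q z c l = ((-1) ^ l * (\<Prod>i<l. z - c * q ^ i)) * q ^ (l choose 2) * rq q (int l) * inverse (qfin c q l)"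
      unfolding gauss_term_def by (simp add: divide_inverse mult_ac)
    also have "\<dots> = qfin q q M *
    (h ^ (2 * (l choose 2) + b * l) * qfin (- (h ^ a)) q l * rq q (int l) * rq q (int M + int l))"
      unfolding P R q_pow[of "l choose 2"] power_add by (simp only: mult_ac)
    finally show ?thesis .
  qed
  have "gauss_term q z c sums (qpoch_inf z q / qpoch_inf c q)" by (rule q_gauss_limit[OF q(1) c1])
  hence "(\<lambda>l. inverse (qfin q q M) * gauss_term q z c l) sums (inverse (qfin q q M) * (qpoch_inf z q / qpoch_inf c q))"
    by (rule sums_mult)
  moreover have "qpoch_inf q q = qfin q q M * qpoch_inf c q" unfolding c_def by (rule qpoch_inf_split[OF q(1)])
  hence "inverse (qfin q q M) * (qpoch_inf z q / qpoch_inf c q) = qpoch_inf (- (h ^ b)) q / qpoch_inf q q"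
    by (simp add: z_def field_simps)
  moreover have "inverse (qfin q q M) * gauss_term q z c l =
     h ^ (2 * (l choose 2) + b * l) * qfin (- (h ^ a)) q l * rq q (int l) * rq q (int M + int l)" for l
    unfolding tm using nz(1) by simp
  ultimately show ?thesis by (simp only:)
qed

lemma h_pow_add_2: "h ^ (M + 2) = h ^ M * q"
  using hq by (simp add: power_add power2_eq_square)

lemma qpoch_inf_half_step:
  "qpoch_inf (- (h ^ M)) q = (1 + h ^ M) * qpoch_inf (- (h ^ (M + 2))) q"
  using qpoch_inf_split[OF q(1), of "- (h ^ M)" 1] unfolding h_pow_add_2 by (simp add: qfin_def)

text \<open>Here l counts s_1 from j upwards, M = m + 2j and h^M = x. The q-Gauss value
  (-h^(M+2))_inf/(q)_inf is rewritten with (-h^M)_inf, the product that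
  \<open>qpoch_half_inf\<close> absorbs.\<close>

lemma last_sum_nat:
  "(\<lambda>l. h powi (int l * int l + (int M + 1) * int l) * qfin (- (h ^ M)) q l * rq q (int l) * rq q (int M + int l))
    sums (qpoch_inf (- (h ^ M)) q / qpoch_inf q q / (1 + h ^ M))"
proof -
  have e: "h powi (int l * int l + (int M + 1) * int l) = h ^ (2 * (l choose 2) + (M + 2) * l)" for l
  proof -
    have "int l * int l + (int M + 1) * int l = int (2 * (l choose 2) + (M + 2) * l)"
      using two_choose_two[of l] by (simp add: algebra_simps)
    thus ?thesis by (simp only: power_int_of_nat)
  qed
  have "qpoch_inf (- (h ^ M)) q / qpoch_inf q q / (1 + h ^ M) = qpoch_inf (- (h ^ (M + 2))) q / qpoch_inf q q"
    unfolding qpoch_inf_half_step[of M] using one_plus_h_powi_nz[of "int M"] by simp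
  thus ?thesis unfolding e using q_gauss_half[of M "M + 2" M] by simp
qed

text \<open>Again 1/(q)_l = q^l/(q)_l + 1/(q)_(l-1). The first part is \<open>last_sum_nat\<close>,
  of value E = (-h^(M+2))_inf/(q)_inf; the second, after a shift of l, is q-Gauss for M + 1, of
  value x (1 + x) E with x = h^M.\<close>

lemma last_sum_nat_lower:
  "(\<lambda>l. h powi (int l * int l + (int M - 1) * int l) * qfin (- (h ^ M)) q l * rq q (int l) * rq q (int M + int l))
    sums (qpoch_inf (- (h ^ M)) q / qpoch_inf q q * (1 + h ^ M + (h ^ M)\<^sup>2) / (1 + h ^ M))"
proof -
  define E where "E = qpoch_inf (- (h ^ (M + 2))) q / qpoch_inf q q"
  have nz: "1 + h ^ M \<noteq> 0" using one_plus_h_powi_nz[of "int M"] by simp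
  define Y where "Y l = h powi (int l * int l + (int M - 1) * int l) * qfin (- (h ^ M)) q l * rq q (int l - 1) * rq q (int M + int l)" for l
  have tm: "h powi (int l * int l + (int M - 1) * int l) * qfin (- (h ^ M)) q l * rq q (int l) * rq q (int M + int l)
    = h powi (int l * int l + (int M + 1) * int l) * qfin (- (h ^ M)) q l * rq q (int l) * rq q (int M + int l) + Y l" for l
  proof -
    have 1: "h powi (int l * int l + (int M + 1) * int l) = h powi (int l * int l + (int M - 1) * int l) * q powi int l"
      unfolding q_powi by (rule powi_eq_mult) (auto simp: h_nz algebra_simps)
    show ?thesis unfolding 1 Y_def rq_rec[OF q(1), of "int l", symmetric] by (simp add: algebra_simps)
  qed
  have Ysuc: "Y (Suc l) = h ^ M * (1 + h ^ M) *
      (h ^ (2 * (l choose 2) + (M + 2) * l) * qfin (- (h ^ (M + 2))) q l * rq q (int l) * rq q (int (Suc M) + int l))" for l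
  proof -
    have "int (Suc l) * int (Suc l) + (int M - 1) * int (Suc l) = int (M + (2 * (l choose 2) + (M + 2) * l))"
      using two_choose_two[of l] by (simp add: algebra_simps)
    hence "h powi (int (Suc l) * int (Suc l) + (int M - 1) * int (Suc l)) = h ^ (M + (2 * (l choose 2) + (M + 2) * l))"
      by (simp only: power_int_of_nat)
    moreover have "qfin (- (h ^ M)) q (Suc l) = (1 + h ^ M) * qfin (- (h ^ (M + 2))) q l"
      unfolding qfin_Suc_shift h_pow_add_2 by simp
    moreover have "int (Suc l) - 1 = int l" "int M + int (Suc l) = int (Suc M) + int l" by simp_all
    ultimately show ?thesis unfolding Y_def by (simp only: power_add mult_ac)
  qed
  have "(\<lambda>l. Y (Suc l)) sums (h ^ M * (1 + h ^ M) * E)"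
    unfolding Ysuc E_def by (intro sums_mult q_gauss_half) simp
  hence "Y sums (h ^ M * (1 + h ^ M) * E)" by (subst (asm) sums_Suc_iff) (simp add: Y_def)
  from sums_add[OF last_sum_nat[of M] this]
  have "(\<lambda>l. h powi (int l * int l + (int M - 1) * int l) * qfin (- (h ^ M)) q l * rq q (int l) * rq q (int M + int l))
    sums (qpoch_inf (- (h ^ M)) q / qpoch_inf q q / (1 + h ^ M) + h ^ M * (1 + h ^ M) * E)" unfolding tm .
  moreover have "qpoch_inf (- (h ^ M)) q / qpoch_inf q q / (1 + h ^ M) + h ^ M * (1 + h ^ M) * E
     = qpoch_inf (- (h ^ M)) q / qpoch_inf q q * (1 + h ^ M + (h ^ M)\<^sup>2) / (1 + h ^ M)"
  proof -
    have "qpoch_inf (- (h ^ M)) q / qpoch_inf q q / (1 + h ^ M) = E"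
      unfolding qpoch_inf_half_step[of M] E_def using nz by simp
    moreover have "qpoch_inf (- (h ^ M)) q / qpoch_inf q q * (1 + h ^ M + (h ^ M)\<^sup>2) / (1 + h ^ M)
       = E * (1 + h ^ M + (h ^ M)\<^sup>2)"
      unfolding qpoch_inf_half_step[of M] E_def using nz by simp
    ultimately show ?thesis by (simp add: algebra_simps power2_eq_square)
  qed
  ultimately show ?thesis by simp
qed

lemma neg_h_pow_q_powi: "- (h ^ m) * q powi j = - (h powi (int m + 2 * j))"
  using powi_eq_mult[OF h_nz, of "int m + 2 * j" "int m" "2 * j"] by (simp add: q_powi)

lemma qpoch_half_add:
  assumes "int m + 2 * j \<ge> 0"
  shows "qpoch (- (h ^ m)) q (j + int l) = qpoch (- (h ^ m)) q j * qfin (- (h ^ nat (int m + 2 * j))) q l"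
proof -
  have e: "- (h ^ m) * q powi j = - (h ^ nat (int m + 2 * j))"
    unfolding neg_h_pow_q_powi using assms by (simp add: power_int_nonneg_exp)
  have "- (h ^ m) * q powi j * q ^ i \<noteq> 1" for i
    unfolding neg_h_pow_q_powi by (intro mult_power_neq_1 q h_powi_nonneg assms)
  from qpoch_add[OF q this] show ?thesis unfolding e .
qed

lemma qpoch_half_inf:
  assumes "int m + 2 * j \<ge> 0"
  shows "qpoch (- (h ^ m)) q j * qpoch_inf (- (h ^ nat (int m + 2 * j))) q = qpoch_inf (- (h ^ m)) q"
proof -
  have e: "- (h ^ m) * q powi j = - (h ^ nat (int m + 2 * j))"
    unfolding neg_h_pow_q_powi using assms by (simp add: power_int_nonneg_exp)
  have "- (h ^ m) * q powi j * q ^ i \<noteq> 1" for i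
    unfolding neg_h_pow_q_powi by (intro mult_power_neq_1 q h_powi_nonneg assms)
  hence "qpoch_inf (- (h ^ m) * q powi j) q \<noteq> 0" by (intro qpoch_inf_nonzero q)
  thus ?thesis unfolding qpoch_def e[symmetric] by simp
qed

lemma qpoch_half_bounded:
  obtains K where "K > 0" "\<And>n. - int (m div 2) \<le> n \<Longrightarrow> norm (qpoch (- (h ^ m)) q n) \<le> K"
proof -
  define L where "L = - int (m div 2)"
  have L: "int m + 2 * L \<ge> 0" by (simp add: L_def)
  define c where "c = - (h ^ nat (int m + 2 * L))"
  obtain K where K: "K > 0" "\<And>n. norm (qfin c q n) \<le> K" using qfin_bounded[OF q(1)] by metis
  show ?thesis
  proof (rule that[of "(norm (qpoch (- (h ^ m)) q L) + 1) * K"])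
    show "(norm (qpoch (- (h ^ m)) q L) + 1) * K > 0" using K by (intro mult_pos_pos add_nonneg_pos) auto
    fix n assume "- int (m div 2) \<le> n"
    hence n: "n = L + int (nat (n - L))" by (simp add: L_def)
    have "norm (qpoch (- (h ^ m)) q n) = norm (qpoch (- (h ^ m)) q L) * norm (qfin c q (nat (n - L)))"
      by (subst n, subst qpoch_half_add[OF L]) (simp add: norm_mult c_def)
    also have "\<dots> \<le> (norm (qpoch (- (h ^ m)) q L) + 1) * K"
      using K by (intro mult_mono) auto
    finally show "norm (qpoch (- (h ^ m)) q n) \<le> (norm (qpoch (- (h ^ m)) q L) + 1) * K" .
  qed
qed

lemma last_weight_bound:
  obtains K where "K > 0" "\<And>n. - int (m div 2) \<le> n \<Longrightarrow>
    norm (h powi (n\<^sup>2 + b * n) * qpoch (- (h ^ m)) q n) \<le> K * norm h ^ nat \<bar>n\<bar>"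
proof -
  obtain K where K: "K > 0" "\<And>n. - int (m div 2) \<le> n \<Longrightarrow> norm (qpoch (- (h ^ m)) q n) \<le> K"
    using qpoch_half_bounded by metis
  define c where "c = (\<bar>b\<bar> + 1)\<^sup>2"
  show ?thesis
  proof (rule that[of "norm h powi (- c) * K"])
    show "norm h powi (- c) * K > 0" using K h_nz by (intro mult_pos_pos zero_less_power_int) auto
    fix n assume n: "- int (m div 2) \<le> n"
    have "norm (h powi (n\<^sup>2 + b * n)) \<le> norm h powi (- c) * norm h ^ nat \<bar>n\<bar>"
      using quadratic_ge_abs[of 1 b "\<bar>b\<bar>" n] by (intro norm_powi_le norm_h h_nz) (auto simp: c_def)
    hence "norm (h powi (n\<^sup>2 + b * n) * qpoch (- (h ^ m)) q n) \<le> (norm h powi (- c) * norm h ^ nat \<bar>n\<bar>) * K"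
      unfolding norm_mult using K(2)[OF n] by (intro mult_mono) auto
    thus "norm (h powi (n\<^sup>2 + b * n) * qpoch (- (h ^ m)) q n) \<le> norm h powi (- c) * K * norm h ^ nat \<bar>n\<bar>"
      by (simp only: mult_ac)
  qed
qed

lemma bU_bounded:
  obtains K where "K > 0" "\<And>n j. norm (bU q m n j) \<le> K"
proof -
  obtain K where K: "K > 0" "\<And>k. norm (rq q k) \<le> K" using rq_bounded[OF q(1)] by metis
  have "norm (bU q m n j) \<le> K * K" for n j
    unfolding bU_def norm_mult using K by (intro mult_mono) (auto simp: less_imp_le)
  thus ?thesis using that[of "K * K"] K by simp
qed

lemma summable_last:
  "(\<lambda>n. h powi (n\<^sup>2 + b * n) * qpoch (- (h ^ m)) q n * bU q m n j) summable_on {- int (m div 2)..}"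
proof -
  obtain K1 where K1: "K1 > 0" "\<And>n. - int (m div 2) \<le> n \<Longrightarrow>
    norm (h powi (n\<^sup>2 + b * n) * qpoch (- (h ^ m)) q n) \<le> K1 * norm h ^ nat \<bar>n\<bar>"
    using last_weight_bound by metis
  obtain K2 where K2: "K2 > 0" "\<And>n j. norm (bU q m n j) \<le> K2" using bU_bounded by metis
  have "(\<lambda>n::int. norm h ^ nat \<bar>n\<bar>) summable_on {- int (m div 2)..}"
    using summable_geometric_int[of "norm h"] norm_h by (auto intro: summable_on_subset_banach)
  hence "(\<lambda>n::int. K1 * norm h ^ nat \<bar>n\<bar> * K2) summable_on {- int (m div 2)..}"
    by (intro summable_on_cmult_left summable_on_cmult_right)
  hence "(\<lambda>n. norm (h powi (n\<^sup>2 + b * n) * qpoch (- (h ^ m)) q n * bU q m n j)) summable_on {- int (m div 2)..}"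
  proof (rule Infinite_Sum.abs_summable_on_comparison_test')
    fix n assume "n \<in> {- int (m div 2)..}"
    hence n: "- int (m div 2) \<le> n" by simp
    have "norm (h powi (n\<^sup>2 + b * n) * qpoch (- (h ^ m)) q n) * norm (bU q m n j) \<le> (K1 * norm h ^ nat \<bar>n\<bar>) * K2"
      using K1 K2 n by (intro mult_mono) auto
    thus "norm (h powi (n\<^sup>2 + b * n) * qpoch (- (h ^ m)) q n * bU q m n j) \<le> K1 * norm h ^ nat \<bar>n\<bar> * K2"
      by (simp only: norm_mult)
  qed
  thus ?thesis by (rule abs_summable_summable)
qed

text \<open>A convergent series alone does not give \<open>has_sum\<close>: summability comes from
  \<open>summable_last\<close>, and the series only identifies the value. The premise on m + 2j puts
  j inside the range of n, and terms below j vanish.\<close>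

lemma has_sum_last_of_sums:
  assumes M: "int m + 2 * j \<ge> 0" "M = nat (int m + 2 * j)"
    and s: "(\<lambda>l. h powi (int l * int l + (int M + b - int m) * int l) * qfin (- (h ^ M)) q l
             * rq q (int l) * rq q (int M + int l)) sums (qpoch_inf (- (h ^ M)) q * v)"
  shows "((\<lambda>n. h powi (n\<^sup>2 + b * n) * qpoch (- (h ^ m)) q n * bU q m n j)
    has_sum (qpoch_inf (- (h ^ m)) q * (h powi (j\<^sup>2 + b * j) * v))) {- int (m div 2)..}"
proof -
  define F where "F n = h powi (n\<^sup>2 + b * n) * qpoch (- (h ^ m)) q n * bU q m n j" for n
  have M': "int M = int m + 2 * j" using M by simp
  have "F summable_on {- int (m div 2)..}" unfolding F_def by (rule summable_last)
  then obtain S where S: "(F has_sum S) {- int (m div 2)..}" by (auto simp: summable_on_def)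
  also have "(F has_sum S) {- int (m div 2)..} \<longleftrightarrow> (F has_sum S) {j..}"
    by (rule has_sum_cong_neutral) (use M in \<open>auto simp: F_def bU_eq_0\<close>)
  also have "\<dots> \<longleftrightarrow> ((\<lambda>l. F (j + int l)) has_sum S) UNIV"
    by (rule has_sum_reindex_bij_witness[of _ "\<lambda>l. j + int l" "\<lambda>n. nat (n - j)"]) auto
  finally have "(\<lambda>l. F (j + int l)) sums S" by (rule has_sum_imp_sums)
  moreover have "F (j + int l) = h powi (j\<^sup>2 + b * j) * qpoch (- (h ^ m)) q j *
      (h powi (int l * int l + (int M + b - int m) * int l) * qfin (- (h ^ M)) q l
             * rq q (int l) * rq q (int M + int l))" for l
  proof -
    have "h powi ((j + int l)\<^sup>2 + b * (j + int l)) = h powi (j\<^sup>2 + b * j) * h powi (int l * int l + (int M + b - int m) * int l)"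
      by (rule powi_eq_mult) (auto simp: h_nz M' power2_eq_square algebra_simps)
    moreover have "bU q m (j + int l) j = rq q (int l) * rq q (int M + int l)"
      by (simp add: bU_def M' algebra_simps)
    ultimately show ?thesis unfolding F_def qpoch_half_add[OF M(1)] M(2)[symmetric] by (simp only: mult_ac)
  qed
  hence "(\<lambda>l. F (j + int l)) sums (h powi (j\<^sup>2 + b * j) * qpoch (- (h ^ m)) q j * (qpoch_inf (- (h ^ M)) q * v))"
    using sums_mult[OF s] by simp
  ultimately have "S = h powi (j\<^sup>2 + b * j) * qpoch (- (h ^ m)) q j * (qpoch_inf (- (h ^ M)) q * v)"
    using sums_unique2 by blast
  also have "\<dots> = (qpoch (- (h ^ m)) q j * qpoch_inf (- (h ^ M)) q) * (h powi (j\<^sup>2 + b * j) * v)" by (simp only: mult_ac)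
  also have "qpoch (- (h ^ m)) q j * qpoch_inf (- (h ^ M)) q = qpoch_inf (- (h ^ m)) q"
    unfolding M(2) by (rule qpoch_half_inf[OF M(1)])
  finally show ?thesis using S unfolding F_def by simp
qed

text \<open>The q-Gauss sum covers m + 2j >= 0. Other j follow by j -> -m-j: the kernel is
  symmetric, and the power of h loses a factor x that 1/(1 + 1/x) = x/(1 + x) returns.\<close>

lemma has_sum_last:
  fixes m :: nat and j :: int
  defines "x \<equiv> \<lambda>j. h powi (int m + 2 * j)"
  shows "((\<lambda>n. h powi (n\<^sup>2 + (int m + 1) * n) * qpoch (- (h ^ m)) q n * bU q m n j)
    has_sum (qpoch_inf (- (h ^ m)) q / qpoch_inf q q * (h powi (j\<^sup>2 + (int m + 1) * j) / (1 + x j)))) {- int (m div 2)..}"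
proof -
  have pos: "((\<lambda>n. h powi (n\<^sup>2 + (int m + 1) * n) * qpoch (- (h ^ m)) q n * bU q m n j)
    has_sum (qpoch_inf (- (h ^ m)) q / qpoch_inf q q * (h powi (j\<^sup>2 + (int m + 1) * j) / (1 + x j)))) {- int (m div 2)..}"
    if "int m + 2 * j \<ge> 0" for j
  proof -
    have "x j = h ^ nat (int m + 2 * j)" using that by (simp add: x_def power_int_nonneg_exp)
    thus ?thesis
      using has_sum_last_of_sums[OF that refl, of "int m + 1" "inverse (qpoch_inf q q) / (1 + x j)"]
        last_sum_nat[of "nat (int m + 2 * j)"] by (simp add: field_simps)
  qed
  show ?thesis
  proof (cases "int m + 2 * j \<ge> 0")
    case False
    define j' where "j' = - int m - j"
    have "int m + 2 * j' \<ge> 0" using False by (simp add: j'_def)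
    note pos[OF this]
    moreover have "bU q m n j' = bU q m n j" for n unfolding j'_def by (rule bU_reflect)
    moreover have "h powi (j'\<^sup>2 + (int m + 1) * j') / (1 + x j') = h powi (j\<^sup>2 + (int m + 1) * j) / (1 + x j)"
    proof -
      have x': "x j' = inverse (x j)" by (simp add: x_def j'_def flip: power_int_minus)
      have nz: "x j \<noteq> 0" "1 + x j \<noteq> 0" using h_nz one_plus_h_powi_nz by (auto simp: x_def)
      have "h powi (j\<^sup>2 + (int m + 1) * j) = h powi (j'\<^sup>2 + (int m + 1) * j') * x j"
        unfolding x_def by (rule powi_eq_mult) (auto simp: h_nz j'_def power2_eq_square algebra_simps)
      thus ?thesis unfolding x' using nz by (simp add: field_simps)
    qed
    ultimately show ?thesis by simp
  qed (rule pos)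
qed

text \<open>The same reflection; now the power of h gains a factor x, and (1 + x + x^2)/(1 + x)
  loses one.\<close>

lemma has_sum_last_lower:
  fixes m :: nat and j :: int
  defines "x \<equiv> \<lambda>j. h powi (int m + 2 * j)"
  shows "((\<lambda>n. h powi (n\<^sup>2 + (int m - 1) * n) * qpoch (- (h ^ m)) q n * bU q m n j)
    has_sum (qpoch_inf (- (h ^ m)) q / qpoch_inf q q * (h powi (j\<^sup>2 + (int m - 1) * j) * (1 + x j + (x j)\<^sup>2) / (1 + x j)))) {- int (m div 2)..}"
proof -
  have pos: "((\<lambda>n. h powi (n\<^sup>2 + (int m - 1) * n) * qpoch (- (h ^ m)) q n * bU q m n j)
    has_sum (qpoch_inf (- (h ^ m)) q / qpoch_inf q q * (h powi (j\<^sup>2 + (int m - 1) * j) * (1 + x j + (x j)\<^sup>2) / (1 + x j)))) {- int (m div 2)..}"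
    if "int m + 2 * j \<ge> 0" for j
  proof -
    have "x j = h ^ nat (int m + 2 * j)" using that by (simp add: x_def power_int_nonneg_exp)
    thus ?thesis
      using has_sum_last_of_sums[OF that refl, of "int m - 1" "inverse (qpoch_inf q q) * (1 + x j + (x j)\<^sup>2) / (1 + x j)"]
        last_sum_nat_lower[of "nat (int m + 2 * j)"] by (simp add: divide_inverse mult_ac)
  qed
  show ?thesis
  proof (cases "int m + 2 * j \<ge> 0")
    case False
    define j' where "j' = - int m - j"
    have "int m + 2 * j' \<ge> 0" using False by (simp add: j'_def)
    note pos[OF this]
    moreover have "bU q m n j' = bU q m n j" for n unfolding j'_def by (rule bU_reflect)
    moreover have "h powi (j'\<^sup>2 + (int m - 1) * j') * (1 + x j' + (x j')\<^sup>2) / (1 + x j')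
        = h powi (j\<^sup>2 + (int m - 1) * j) * (1 + x j + (x j)\<^sup>2) / (1 + x j)"
    proof -
      have x': "x j' = inverse (x j)" by (simp add: x_def j'_def flip: power_int_minus)
      have nz: "x j \<noteq> 0" "1 + x j \<noteq> 0" using h_nz one_plus_h_powi_nz by (auto simp: x_def)
      have "h powi (j'\<^sup>2 + (int m - 1) * j') = h powi (j\<^sup>2 + (int m - 1) * j) * x j"
        unfolding x_def by (rule powi_eq_mult) (auto simp: h_nz j'_def power2_eq_square algebra_simps)
      moreover have "y * (1 + inverse y + (inverse y)\<^sup>2) / (1 + inverse y) = (1 + y + y\<^sup>2) / (1 + y)"
        if "y \<noteq> 0" "1 + y \<noteq> 0" for y :: complex
      proof -
        have "1 + inverse y = (1 + y) / y" "1 + inverse y + (inverse y)\<^sup>2 = (1 + y + y\<^sup>2) / y\<^sup>2"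
          using that by (simp_all add: field_simps power2_eq_square)
        thus ?thesis using that by (simp add: power2_eq_square)
      qed
      ultimately show ?thesis unfolding x' using nz by (metis mult.assoc times_divide_eq_right)
    qed
    ultimately show ?thesis by simp
  qed (rule pos)
qed

end

section \<open>The kernel summed over s_1, and the exchange of the two sums\<close>

lemma has_sum_minus:
  fixes f g :: "'a \<Rightarrow> complex"
  assumes "(f has_sum a) A" "(g has_sum b) A"
  shows "((\<lambda>x. f x - g x) has_sum (a - b)) A"
  using has_sum_add[OF assms(1) has_sum_uminusI[OF assms(2)]] by simp

text \<open>Turns the polynomials in y = x^2 left by the lowered steps into the full geometric sum
  in x.\<close>

lemma sum_even_odd_powers:
  fixes x :: complex
  shows "(\<Sum>k\<le>2 * i. x ^ k) = (1 + x) * (\<Sum>k<i. (x\<^sup>2) ^ k) + x ^ (2 * i)"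
proof (induction i)
  case (Suc i)
  have "(\<Sum>k\<le>2 * Suc i. x ^ k) = (\<Sum>k\<le>2 * i. x ^ k) + x * x ^ (2 * i) + x ^ (2 * Suc i)" by simp
  moreover have "(\<Sum>k<Suc i. (x\<^sup>2) ^ k) = (\<Sum>k<i. (x\<^sup>2) ^ k) + x ^ (2 * i)"
    by (simp add: power_mult)
  ultimately show ?case unfolding Suc.IH by (simp only: distrib_left distrib_right mult_1 add_ac)
qed simp

lemma sum_alternating_powers:
  fixes x :: complex
  assumes "1 + x \<noteq> 0"
  shows "(1 + (-1) ^ m * x ^ Suc m) / (1 + x) = (\<Sum>l\<le>m. (-1) ^ l * x ^ l)"
proof -
  have "(1 + x) * (\<Sum>l\<le>m. (-1) ^ l * x ^ l) = 1 + (-1) ^ m * x ^ Suc m"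
    by (induction m) (simp_all add: algebra_simps)
  thus ?thesis using assms by (simp add: field_simps)
qed

text \<open>Twice the exponent of q in the final series, for use as a power of h.\<close>

definition theta_exp :: "nat \<Rightarrow> nat \<Rightarrow> nat \<Rightarrow> int \<Rightarrow> int" where
  "theta_exp m r i t = 2 * int r * t\<^sup>2 + (2 * int r - 1) * int m * t - 2 * int i * t"

definition folded_term :: "complex \<Rightarrow> nat \<Rightarrow> nat \<Rightarrow> nat \<Rightarrow> int \<Rightarrow> complex" where
  "folded_term h m r i t = (-1) powi t * h powi theta_exp m r i t
     * (\<Sum>k\<le>2 * i. (h powi (int m + 2 * t)) ^ k) / (1 + h powi (int m + 2 * t))"

definition first_weight :: "complex \<Rightarrow> complex \<Rightarrow> nat \<Rightarrow> nat \<Rightarrow> int \<Rightarrow> complex" where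
  "first_weight h q m i n = h powi (n\<^sup>2 + (if i = 0 then int m + 1 else int m - 1) * n) * qpoch (- (h ^ m)) q n"

text \<open>The number r - max(i, 1) counts the ordinary Bailey steps, for s_r, ..., s_(i+1); as s_1
  is always left to q-Gauss, i = 0 also gives r - 1.\<close>

definition outer_alpha :: "complex \<Rightarrow> nat \<Rightarrow> nat \<Rightarrow> nat \<Rightarrow> int \<Rightarrow> complex" where
  "outer_alpha q m r i t = balpha q t * q powi (int (r - max i 1) * (t\<^sup>2 + int m * t))"

context half_base
begin

lemma balpha_h: "balpha q t = (-1) powi t * h powi (t\<^sup>2 - t)"
proof -
  have "2 * (t * (t - 1) div 2) = t * (t - 1)" by simp
  thus ?thesis unfolding balpha_def q_powi by (simp add: power2_eq_square algebra_simps)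
qed

lemma outer_alpha_h:
  "outer_alpha q m r i t = (-1) powi t * h powi (t\<^sup>2 - t + 2 * (int (r - max i 1) * (t\<^sup>2 + int m * t)))"
  unfolding outer_alpha_def balpha_h q_powi
    powi_eq_mult[OF h_nz refl, of "t\<^sup>2 - t" "2 * (int (r - max i 1) * (t\<^sup>2 + int m * t))"]
  by (simp only: mult_ac)

text \<open>For i >= 1 the mechanism of \<open>bG_step\<close> recurs: q^(m+n+t) raises h^((m-1)n)
  to h^((m+1)n), so the geometric sums P and R in x^2 meet \<open>has_sum_last_lower\<close> and
  \<open>has_sum_last\<close>. The numerator is (1 + x + x^2) P - x^2 R = (1 + x) P + x^(2i),
  because P - R = x^(2(i-1)).\<close>

lemma has_sum_first_index:
  assumes r: "2 \<le> r" "i \<le> r - 1"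
  shows "((\<lambda>n. first_weight h q m i n * (outer_alpha q m r i t * bG q m (i - 1) n t))
    has_sum (qpoch_inf (- (h ^ m)) q / qpoch_inf q q * folded_term h m r i t)) {- int (m div 2)..}"
proof (cases "i = 0")
  case True
  have "((\<lambda>n. outer_alpha q m r i t * (h powi (n\<^sup>2 + (int m + 1) * n) * qpoch (- (h ^ m)) q n * bU q m n t))
    has_sum (outer_alpha q m r i t * (qpoch_inf (- (h ^ m)) q / qpoch_inf q q * (h powi (t\<^sup>2 + (int m + 1) * t) / (1 + h powi (int m + 2 * t))))))
      {- int (m div 2)..}"
    by (intro has_sum_cmult_right has_sum_last)
  moreover have "outer_alpha q m r i t * h powi (t\<^sup>2 + (int m + 1) * t) = (-1) powi t * h powi theta_exp m r i t"
  proof -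
    have "h powi theta_exp m r i t = h powi (t\<^sup>2 - t + 2 * (int (r - max i 1) * (t\<^sup>2 + int m * t))) * h powi (t\<^sup>2 + (int m + 1) * t)"
      using r by (intro powi_eq_mult h_nz) (auto simp: True theta_exp_def of_nat_diff algebra_simps)
    thus ?thesis by (simp add: outer_alpha_h mult_ac)
  qed
  hence "outer_alpha q m r i t * (qpoch_inf (- (h ^ m)) q / qpoch_inf q q * (h powi (t\<^sup>2 + (int m + 1) * t) / (1 + h powi (int m + 2 * t))))
     = qpoch_inf (- (h ^ m)) q / qpoch_inf q q * folded_term h m r i t"
    by (simp add: folded_term_def True divide_inverse mult_ac)
  ultimately show ?thesis by (simp add: True first_weight_def bG_0 mult_ac)
next
  case False
  define x where "x = h powi (int m + 2 * t)"
  define C where "C = qpoch_inf (- (h ^ m)) q / qpoch_inf q q"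
  define W where "W = outer_alpha q m r i t * q powi (int (i - 1) * (t\<^sup>2 + (int m - 1) * t))"
  define P where "P = (\<Sum>k\<le>i - 1. (x\<^sup>2) ^ k)"
  define R where "R = (\<Sum>k<i - 1. (x\<^sup>2) ^ k)"
  define V where "V = h powi (t\<^sup>2 + (int m - 1) * t)"
  have y: "q powi (int m + 2 * t) = x\<^sup>2"
    unfolding x_def q_powi power_int_power' by (simp add: mult.commute)
  have PR: "P = R + (x\<^sup>2) ^ (i - 1)" unfolding P_def R_def by (simp add: lessThan_Suc_atMost[symmetric])
  have "(\<Sum>k<i. (x\<^sup>2) ^ k) = P" using False unfolding P_def by (cases i) (auto simp: lessThan_Suc_atMost)
  hence PX: "(\<Sum>k\<le>2 * i. x ^ k) = (1 + x) * P + x ^ (2 * i)" by (simp add: sum_even_odd_powers)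
  have xi: "x\<^sup>2 * (x\<^sup>2) ^ (i - 1) = x ^ (2 * i)" using False unfolding power_mult by (cases i) simp_all
  have Vx: "h powi (2 * (int m + t)) * h powi (t\<^sup>2 + (int m + 1) * t) = V * x\<^sup>2"
    unfolding V_def x_def power_int_power' power_int_add[symmetric, OF disjI1[OF h_nz]]
    by (rule arg_cong[where f = "power_int h"]) (simp add: algebra_simps)
  have tm: "first_weight h q m i n * (outer_alpha q m r i t * bG q m (i - 1) n t)
      = W * P * (h powi (n\<^sup>2 + (int m - 1) * n) * qpoch (- (h ^ m)) q n * bU q m n t)
      - W * R * h powi (2 * (int m + t)) * (h powi (n\<^sup>2 + (int m + 1) * n) * qpoch (- (h ^ m)) q n * bU q m n t)" for n
  proof -
    have "h powi (n\<^sup>2 + (int m - 1) * n) * q powi (int m + n + t) = h powi (2 * (int m + t)) * h powi (n\<^sup>2 + (int m + 1) * n)"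
      unfolding q_powi power_int_add[symmetric, OF disjI1[OF h_nz]]
      by (rule arg_cong[where f = "power_int h"]) (simp add: algebra_simps)
    thus ?thesis using False
      unfolding bG_def y P_def[symmetric] R_def[symmetric] W_def first_weight_def
      by (simp add: algebra_simps)
  qed
  have "((\<lambda>n. first_weight h q m i n * (outer_alpha q m r i t * bG q m (i - 1) n t)) has_sum
     (W * P * (C * (V * (1 + x + x\<^sup>2) / (1 + x)))
       - W * R * h powi (2 * (int m + t)) * (C * (h powi (t\<^sup>2 + (int m + 1) * t) / (1 + x))))) {- int (m div 2)..}"
    unfolding tm C_def x_def V_def
    by (intro has_sum_minus has_sum_cmult_right has_sum_last has_sum_last_lower)
  also have "W * P * (C * (V * (1 + x + x\<^sup>2) / (1 + x)))
       - W * R * h powi (2 * (int m + t)) * (C * (h powi (t\<^sup>2 + (int m + 1) * t) / (1 + x)))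
     = W * P * (C * (V * (1 + x + x\<^sup>2) / (1 + x)))
       - W * R * (C * ((h powi (2 * (int m + t)) * h powi (t\<^sup>2 + (int m + 1) * t)) / (1 + x)))"
    by (simp only: mult_ac times_divide_eq_right)
  also have "\<dots> = C * (W * V * ((1 + x) * P + x\<^sup>2 * (P - R)) / (1 + x))"
    unfolding Vx by (simp add: divide_inverse algebra_simps)
  also have "x\<^sup>2 * (P - R) = x ^ (2 * i)" unfolding PR by (simp only: add_diff_cancel_left' xi)
  also have "(1 + x) * P + x ^ (2 * i) = (\<Sum>k\<le>2 * i. x ^ k)" by (rule PX[symmetric])
  also have "W * V = (-1) powi t * h powi theta_exp m r i t"
  proof -
    have mx: "max i 1 = i" using False by simp
    have "h powi theta_exp m r i t = h powi (t\<^sup>2 - t + 2 * (int (r - max i 1) * (t\<^sup>2 + int m * t)))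
        * h powi (2 * (int (i - 1) * (t\<^sup>2 + (int m - 1) * t)) + (t\<^sup>2 + (int m - 1) * t))"
      using r False mx by (intro powi_eq_mult h_nz) (auto simp: theta_exp_def of_nat_diff algebra_simps)
    moreover have "h powi (2 * (int (i - 1) * (t\<^sup>2 + (int m - 1) * t)) + (t\<^sup>2 + (int m - 1) * t))
       = h powi (2 * (int (i - 1) * (t\<^sup>2 + (int m - 1) * t))) * V"
      unfolding V_def by (intro powi_eq_mult h_nz refl)
    ultimately show ?thesis by (simp only: W_def outer_alpha_h q_powi mult_ac)
  qed
  finally show ?thesis unfolding C_def folded_term_def x_def .
qed

text \<open>Decay in t, uniformly in n. The factor \<open>balpha\<close> alone, with h-exponent t^2
  - t, makes the leading coefficient a >= 1; B dominates the linear coefficient for every k <=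
  j.\<close>

lemma outer_bound:
  obtains K where "K > 0" "\<And>n t. norm (outer_alpha q m r i t * bG q m j n t) \<le> K * norm h ^ nat \<bar>t\<bar>"
proof -
  define R where "R = int (r - max i 1)"
  obtain K where K: "K > 0" "\<And>n t. norm (bU q m n t) \<le> K" using bU_bounded[of m] by metis
  define a where "a = 1 + 2 * R + 2 * int j"
  define B where "B = 1 + 2 * R * int m + 2 * int j * (int m + 1) + 4 * int j"
  define c where "c = (B + 1)\<^sup>2"
  define G where "G t = norm h powi (- c) * norm h ^ nat \<bar>t\<bar>" for t
  have G0: "G t \<ge> 0" for t by (simp add: G_def zero_le_power_int)
  have R0: "R \<ge> 0" by (simp add: R_def)
  define T where "T t = outer_alpha q m r i t * q powi (int j * (t\<^sup>2 + (int m - 1) * t))" for t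
  have Tk: "norm (T t * (q powi (int m + 2 * t)) ^ k) \<le> G t" if "k \<le> j" for t k
  proof -
    define b where "b = 2 * R * int m - 1 + 2 * int j * (int m - 1) + 4 * int k"
    have "T t * (q powi (int m + 2 * t)) ^ k = (-1) powi t * (h powi (t\<^sup>2 - t + 2 * (R * (t\<^sup>2 + int m * t)))
        * h powi (2 * (int j * (t\<^sup>2 + (int m - 1) * t))) * h powi (2 * (int m + 2 * t) * int k))"
      unfolding T_def outer_alpha_h q_powi R_def power_int_power' by (simp only: mult_ac)
    also have "h powi (t\<^sup>2 - t + 2 * (R * (t\<^sup>2 + int m * t)))
        * h powi (2 * (int j * (t\<^sup>2 + (int m - 1) * t))) * h powi (2 * (int m + 2 * t) * int k)
       = h powi (a * t\<^sup>2 + b * t + 2 * int m * int k)"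
      unfolding power_int_add[symmetric, OF disjI1[OF h_nz]]
      by (rule arg_cong[where f = "power_int h"]) (simp add: a_def b_def algebra_simps)
    finally have "norm (T t * (q powi (int m + 2 * t)) ^ k) = norm (h powi (a * t\<^sup>2 + b * t + 2 * int m * int k))"
      by (simp add: norm_mult norm_power_int)
    also have "\<dots> \<le> G t" unfolding G_def
    proof (intro norm_powi_le norm_h h_nz)
      have j0: "0 \<le> int j * (int m - 1) + int j" by (simp add: algebra_simps)
      have "0 \<le> R * int m" using R0 by simp
      hence "\<bar>b\<bar> \<le> B" using that j0 unfolding b_def B_def by (simp add: algebra_simps abs_le_iff)
      moreover have "a \<ge> 1" using R0 by (simp add: a_def)
      ultimately have "\<bar>t\<bar> - c \<le> a * t\<^sup>2 + b * t" unfolding c_def by (intro quadratic_ge_abs)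
      moreover have "0 \<le> 2 * int m * int k" by simp
      ultimately show "\<bar>t\<bar> - c \<le> a * t\<^sup>2 + b * t + 2 * int m * int k" by linarith
    qed
    finally show ?thesis .
  qed
  have main: "norm (outer_alpha q m r i t * bG q m j n t) \<le> (2 * real j + 1) * G t * K" for n t
  \<comment> \<open>|q^(m+n+t)| <= 1 needs m + n + t >= 0; in the other case the kernel is
    0.\<close>
  proof (cases "int m + n + t \<ge> 0")
    case False
    thus ?thesis using G0 K(1) by (simp add: bG_def bU_eq_0)
  next
    case True
    define y where "y = q powi (int m + 2 * t)"
    have "norm (q powi (int m + n + t)) \<le> 1"
      using True norm_q_powi_lt_1[OF q, of "int m + n + t"] by (cases "int m + n + t = 0") auto
    have "outer_alpha q m r i t * bG q m j n t = ((\<Sum>k\<le>j. T t * y ^ k) - q powi (int m + n + t) * (\<Sum>k<j. T t * y ^ k)) * bU q m n t"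
      unfolding bG_def T_def y_def sum_distrib_left[symmetric] by (simp add: algebra_simps)
    also have "norm \<dots> = norm ((\<Sum>k\<le>j. T t * y ^ k) - q powi (int m + n + t) * (\<Sum>k<j. T t * y ^ k)) * norm (bU q m n t)"
      by (rule norm_mult)
    also have "\<dots> \<le> ((2 * real j + 1) * G t) * K"
    proof (intro mult_mono K)
      have 1: "norm (\<Sum>k\<le>j. T t * y ^ k) \<le> real (card {..j}) * G t"
        using Tk unfolding y_def by (intro sum_norm_bound) auto
      have "norm (\<Sum>k<j. T t * y ^ k) \<le> real (card {..<j}) * G t"
        using Tk unfolding y_def by (intro sum_norm_bound) auto
      hence "norm (q powi (int m + n + t)) * norm (\<Sum>k<j. T t * y ^ k) \<le> 1 * (real (card {..<j}) * G t)"
        using \<open>norm (q powi (int m + n + t)) \<le> 1\<close> by (intro mult_mono) auto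
      hence 2: "norm (q powi (int m + n + t) * (\<Sum>k<j. T t * y ^ k)) \<le> real (card {..<j}) * G t"
        by (simp add: norm_mult)
      have "norm ((\<Sum>k\<le>j. T t * y ^ k) - q powi (int m + n + t) * (\<Sum>k<j. T t * y ^ k))
          \<le> real (card {..j}) * G t + real (card {..<j}) * G t"
        using norm_triangle_ineq4 1 2 by (meson add_mono order_trans)
      thus "norm ((\<Sum>k\<le>j. T t * y ^ k) - q powi (int m + n + t) * (\<Sum>k<j. T t * y ^ k)) \<le> (2 * real j + 1) * G t"
        by (simp add: algebra_simps)
    qed (use G0 in auto)
    finally show ?thesis .
  qed
  show ?thesis
  proof (rule that[of "(2 * real j + 1) * norm h powi (- c) * K"])
    show "(2 * real j + 1) * norm h powi (- c) * K > 0"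
      using K h_nz by (intro mult_pos_pos zero_less_power_int) auto
    show "norm (outer_alpha q m r i t * bG q m j n t) \<le> (2 * real j + 1) * norm h powi (- c) * K * norm h ^ nat \<bar>t\<bar>" for n t
      using main[of t n] by (simp add: G_def mult_ac)
  qed
qed

lemma summable_double:
  "(\<lambda>(n, t). first_weight h q m i n * (outer_alpha q m r i t * bG q m j n t)) summable_on ({- int (m div 2)..} \<times> UNIV)"
proof -
  obtain K1 where K1: "K1 > 0" "\<And>n. - int (m div 2) \<le> n \<Longrightarrow> norm (first_weight h q m i n) \<le> K1 * norm h ^ nat \<bar>n\<bar>"
    unfolding first_weight_def using last_weight_bound by metis
  obtain K2 where K2: "K2 > 0" "\<And>n t. norm (outer_alpha q m r i t * bG q m j n t) \<le> K2 * norm h ^ nat \<bar>t\<bar>"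
    using outer_bound by metis
  define \<rho> where "\<rho> = norm h"
  have g: "(\<lambda>n::int. \<rho> ^ nat \<bar>n\<bar>) summable_on A" for A
    using summable_geometric_int[of \<rho>] norm_h unfolding \<rho>_def by (auto intro: summable_on_subset_banach)
  have "(\<lambda>(n, t). \<rho> ^ nat \<bar>n\<bar> * \<rho> ^ nat \<bar>t\<bar>) summable_on ({- int (m div 2)..} \<times> (UNIV :: int set))"
  proof (rule summable_on_SigmaI)
    show "((\<lambda>t. case (n, t) of (n, t) \<Rightarrow> \<rho> ^ nat \<bar>n\<bar> * \<rho> ^ nat \<bar>t\<bar>)
        has_sum (\<rho> ^ nat \<bar>n\<bar> * (\<Sum>\<^sub>\<infinity>t::int. \<rho> ^ nat \<bar>t\<bar>))) UNIV" for n :: int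
      using has_sum_cmult_right[OF has_sum_infsum[OF g]] by simp
    show "(\<lambda>n::int. \<rho> ^ nat \<bar>n\<bar> * (\<Sum>\<^sub>\<infinity>t::int. \<rho> ^ nat \<bar>t\<bar>)) summable_on {- int (m div 2)..}"
      by (intro summable_on_cmult_left g)
  qed (auto simp: \<rho>_def)
  hence "(\<lambda>x. (K1 * K2) * (\<rho> ^ nat \<bar>fst x\<bar> * \<rho> ^ nat \<bar>snd x\<bar>)) summable_on ({- int (m div 2)..} \<times> (UNIV :: int set))"
    unfolding case_prod_unfold by (rule summable_on_cmult_right)
  hence "(\<lambda>x. norm (first_weight h q m i (fst x) * (outer_alpha q m r i (snd x) * bG q m j (fst x) (snd x))))
      summable_on ({- int (m div 2)..} \<times> (UNIV :: int set))"
  proof (rule Infinite_Sum.abs_summable_on_comparison_test')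
    fix x assume "x \<in> {- int (m div 2)..} \<times> (UNIV :: int set)"
    hence "- int (m div 2) \<le> fst x" by auto
    hence "norm (first_weight h q m i (fst x)) * norm (outer_alpha q m r i (snd x) * bG q m j (fst x) (snd x))
       \<le> (K1 * \<rho> ^ nat \<bar>fst x\<bar>) * (K2 * \<rho> ^ nat \<bar>snd x\<bar>)"
      using K1 K2 unfolding \<rho>_def by (intro mult_mono) auto
    thus "norm (first_weight h q m i (fst x) * (outer_alpha q m r i (snd x) * bG q m j (fst x) (snd x)))
       \<le> (K1 * K2) * (\<rho> ^ nat \<bar>fst x\<bar> * \<rho> ^ nat \<bar>snd x\<bar>)"
      unfolding norm_mult[of "first_weight h q m i (fst x)"] by (simp only: mult_ac)
  qed
  from abs_summable_summable[OF this] show ?thesis by (simp add: case_prod_unfold)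
qed

text \<open>One summable double family, summed in both orders. For fixed n only -m-n <= t <= n
  contribute; for fixed t the sum over n is \<open>has_sum_first_index\<close>.\<close>

lemma has_sum_double:
  assumes r: "2 \<le> r" "i \<le> r - 1"
  obtains S where "((\<lambda>n. first_weight h q m i n * (\<Sum>t\<in>{- int m - n..n}. outer_alpha q m r i t * bG q m (i - 1) n t)) has_sum S) {- int (m div 2)..}"
    and "((\<lambda>t. qpoch_inf (- (h ^ m)) q / qpoch_inf q q * folded_term h m r i t) has_sum S) UNIV"
proof -
  define H where "H = (\<lambda>(n, t). first_weight h q m i n * (outer_alpha q m r i t * bG q m (i - 1) n t))"
  obtain S where S: "(H has_sum S) ({- int (m div 2)..} \<times> UNIV)"
    using summable_double[of m i r "i - 1"] unfolding H_def summable_on_def by blast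
  have "((\<lambda>n. first_weight h q m i n * (\<Sum>t\<in>{- int m - n..n}. outer_alpha q m r i t * bG q m (i - 1) n t)) has_sum S) {- int (m div 2)..}"
  proof (rule has_sum_SigmaD[OF S])
    fix n assume "n \<in> {- int (m div 2)..}"
    have "((\<lambda>t. outer_alpha q m r i t * bG q m (i - 1) n t) has_sum (\<Sum>t\<in>{- int m - n..n}. outer_alpha q m r i t * bG q m (i - 1) n t)) UNIV"
      by (intro has_sum_finite_neutralI[of "{- int m - n..n}"]) (auto simp: bG_def bU_def rq_def)
    thus "((\<lambda>y. H (n, y)) has_sum first_weight h q m i n * (\<Sum>t\<in>{- int m - n..n}. outer_alpha q m r i t * bG q m (i - 1) n t)) UNIV"
      unfolding H_def by (simp add: has_sum_cmult_right)
  qed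
  moreover have "((\<lambda>t. qpoch_inf (- (h ^ m)) q / qpoch_inf q q * folded_term h m r i t) has_sum S) UNIV"
  proof (rule has_sum_SigmaD)
    show "((\<lambda>(t, n). H (n, t)) has_sum S) (UNIV \<times> {- int (m div 2)..})"
      using S has_sum_swap by blast
    show "((\<lambda>n. case (t, n) of (t, n) \<Rightarrow> H (n, t)) has_sum qpoch_inf (- (h ^ m)) q / qpoch_inf q q * folded_term h m r i t) {- int (m div 2)..}" for t
      using has_sum_first_index[OF r, where m = m and t = t] by (simp add: H_def)
  qed
  ultimately show ?thesis by (rule that)
qed

end

section \<open>Symmetrisation and theta functions\<close>

lemma sum_powers_inverse:
  fixes x :: complex
  assumes "x \<noteq> 0"
  shows "(\<Sum>k\<le>n. inverse x ^ k) = inverse x ^ n * (\<Sum>k\<le>n. x ^ k)"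
proof -
  have "(\<Sum>k\<le>n. inverse x ^ k) = (\<Sum>k\<le>n. inverse x ^ (n - k))"
    by (rule sum.nat_diff_reindex[of "\<lambda>k. inverse x ^ k" "Suc n", symmetric, unfolded lessThan_Suc_atMost diff_Suc_Suc])
  also have "\<dots> = (\<Sum>k\<le>n. inverse x ^ n * x ^ k)"
  proof (intro sum.cong refl)
    fix k assume "k \<in> {..n}"
    hence "inverse x ^ n = inverse x ^ (n - k) * inverse x ^ k" by (simp flip: power_add)
    thus "inverse x ^ (n - k) = inverse x ^ n * x ^ k" using assms by (simp add: power_inverse)
  qed
  finally show ?thesis by (simp add: sum_distrib_left)
qed

text \<open>The alternating sum is (1 - x) (1 + x^2 + ... + x^(2p)), and 1 - x collapses the other
  factor to 1 - x^(2i+1). So for odd m only single sums of theta series remain.\<close>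

lemma sum_powers_mult_alternating:
  fixes x :: complex
  shows "(\<Sum>k\<le>2 * i. x ^ k) * (\<Sum>l\<le>2 * p + 1. (-1) ^ l * x ^ l)
    = (\<Sum>l\<le>p. x ^ (2 * l)) - (\<Sum>l\<le>p. x ^ (2 * l + 2 * i + 1))"
proof -
  have 1: "(\<Sum>l\<le>2 * p + 1. (-1) ^ l * x ^ l) = (1 - x) * (\<Sum>l\<le>p. x ^ (2 * l))"
    by (induction p) (simp_all add: algebra_simps)
  have 2: "(\<Sum>k\<le>n. x ^ k) * (1 - x) = 1 - x ^ Suc n" for n
  proof (induction n)
    case (Suc n)
    have "(\<Sum>k\<le>Suc n. x ^ k) * (1 - x) = (\<Sum>k\<le>n. x ^ k) * (1 - x) + x ^ Suc n * (1 - x)"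
      by (simp only: sum.atMost_Suc distrib_right)
    also have "\<dots> = 1 - x ^ Suc (Suc n)" unfolding Suc.IH by (simp add: algebra_simps)
    finally show ?case .
  qed simp
  have "(\<Sum>k\<le>2 * i. x ^ k) * (\<Sum>l\<le>2 * p + 1. (-1) ^ l * x ^ l)
      = ((\<Sum>k\<le>2 * i. x ^ k) * (1 - x)) * (\<Sum>l\<le>p. x ^ (2 * l))"
    unfolding 1 by (simp only: mult_ac)
  also have "\<dots> = (\<Sum>l\<le>p. x ^ (2 * l)) - x ^ Suc (2 * i) * (\<Sum>l\<le>p. x ^ (2 * l))"
    unfolding 2 by (simp only: left_diff_distrib mult_1)
  also have "x ^ Suc (2 * i) * (\<Sum>l\<le>p. x ^ (2 * l)) = (\<Sum>l\<le>p. x ^ (2 * l + 2 * i + 1))"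
    unfolding sum_distrib_left by (intro sum.cong refl) (simp add: power_add)
  finally show ?thesis .
qed

lemma has_sum_sum:
  fixes f :: "'b \<Rightarrow> 'a \<Rightarrow> complex"
  assumes "finite I" "\<And>i. i \<in> I \<Longrightarrow> (f i has_sum s i) A"
  shows "((\<lambda>x. \<Sum>i\<in>I. f i x) has_sum (\<Sum>i\<in>I. s i)) A"
  using assms by (induction I rule: finite_induct) (auto intro!: has_sum_add)

lemma has_sum_translate_int:
  fixes f :: "int \<Rightarrow> complex"
  shows "((\<lambda>t. f (t + a)) has_sum S) UNIV \<longleftrightarrow> (f has_sum S) UNIV"
  by (rule has_sum_reindex_bij_witness[of _ "\<lambda>t. t - a" "\<lambda>t. t + a"]) auto

lemma has_sum_reflect_int:
  fixes f :: "int \<Rightarrow> complex"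
  shows "((\<lambda>t. f (a - t)) has_sum S) UNIV \<longleftrightarrow> (f has_sum S) UNIV"
  by (rule has_sum_reindex_bij_witness[of _ "\<lambda>t. a - t" "\<lambda>t. a - t"]) auto

definition xh :: "complex \<Rightarrow> nat \<Rightarrow> int \<Rightarrow> complex" where
  "xh h m t = h powi (int m + 2 * t)"

definition eh :: "complex \<Rightarrow> nat \<Rightarrow> nat \<Rightarrow> nat \<Rightarrow> int \<Rightarrow> complex" where
  "eh h m r i t = (-1) powi t * h powi theta_exp m r i t"

context half_base
begin

context
  fixes m r i :: nat
  assumes r: "r > 0"
begin


lemma xh_nz: "xh h m t \<noteq> 0"
  using h_nz by (simp add: xh_def)

lemma xh_reflect: "xh h m (- int m - t) = inverse (xh h m t)"
  unfolding xh_def power_int_minus[symmetric] by (rule arg_cong[where f = "power_int h"]) simp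

lemma eh_reflect: "eh h m r i (- int m - t) = (-1) ^ m * eh h m r i t * xh h m t ^ (m + 2 * i)"
proof -
  have "(-1::complex) powi (- int m - t) = (-1) ^ m * (-1) powi t"
    by (simp add: power_int_diff power_int_minus field_simps flip: power_mult_distrib power_int_mult_distrib)
  moreover have "xh h m t ^ (m + 2 * i) = h powi ((int m + 2 * t) * (int m + 2 * int i))"
    by (simp add: xh_def power_int_power')
  moreover have "h powi theta_exp m r i (- int m - t) = h powi theta_exp m r i t * h powi ((int m + 2 * t) * (int m + 2 * int i))"
    by (rule powi_eq_mult) (auto simp: h_nz theta_exp_def power2_eq_square algebra_simps)
  ultimately show ?thesis by (simp only: eh_def mult_ac)
qed

text \<open>Reflection multiplies \<open>eh\<close> by (-1)^m x^(m+2i) and the geometric sum by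
  x^(-2i), and turns 1/(1 + x) into x/(1 + x). Together the two terms have numerator 1 + (-1)^m
  x^(m+1), which 1 + x divides.\<close>

lemma folded_term_symmetrise:
  "folded_term h m r i t + folded_term h m r i (- int m - t)
    = eh h m r i t * ((\<Sum>k\<le>2 * i. xh h m t ^ k) * (\<Sum>l\<le>m. (-1) ^ l * xh h m t ^ l))"
proof -
  define x where "x = xh h m t"
  define K where "K = (\<Sum>k\<le>2 * i. x ^ k)"
  have x0: "x \<noteq> 0" unfolding x_def by (rule xh_nz)
  have x1: "1 + x \<noteq> 0" unfolding x_def xh_def by (rule one_plus_h_powi_nz)
  have f: "folded_term h m r i u = eh h m r i u * (\<Sum>k\<le>2 * i. xh h m u ^ k) / (1 + xh h m u)" for u
    by (simp add: folded_term_def eh_def xh_def)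
  have "folded_term h m r i (- int m - t) = (-1) ^ m * eh h m r i t * x ^ (m + 2 * i) * (inverse x ^ (2 * i) * K) / (1 + inverse x)"
    unfolding f eh_reflect xh_reflect x_def[symmetric] K_def sum_powers_inverse[OF x0] ..
  also have "\<dots> = (-1) ^ m * eh h m r i t * (x ^ (m + 2 * i) * inverse x ^ (2 * i)) * K / (1 + inverse x)"
    by (simp only: mult_ac)
  also have "x ^ (m + 2 * i) * inverse x ^ (2 * i) = x ^ m"
    using x0 by (simp add: power_add power_inverse)
  also have "1 + inverse x = (1 + x) / x" using x0 by (simp add: field_simps)
  also have "(-1) ^ m * eh h m r i t * x ^ m * K / ((1 + x) / x) = eh h m r i t * K * ((-1) ^ m * x ^ Suc m / (1 + x))" by simp
  finally have "folded_term h m r i t + folded_term h m r i (- int m - t)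
      = eh h m r i t * K * ((1 + (-1) ^ m * x ^ Suc m) / (1 + x))"
    unfolding f[of t] x_def[symmetric] K_def[symmetric] by (simp add: add_divide_distrib algebra_simps)
  also have "\<dots> = eh h m r i t * (K * (\<Sum>l\<le>m. (-1) ^ l * x ^ l))"
    unfolding sum_alternating_powers[OF x1] by (simp only: mult_ac)
  finally show ?thesis unfolding K_def x_def .
qed

text \<open>The parameter \<open>c\<close> is the translation needed to bring the theta series into the normal
  form of the triple product; it is \<open>0\<close> for even \<open>m\<close> and \<open>m div 2\<close> for odd \<open>m\<close>.\<close>

lemma has_sum_theta:
  fixes a :: nat and c :: int
  defines "b \<equiv> (2 * int r - 1) * int m - 2 * int i + 2 * int a - 4 * int r * c"
  shows "((\<lambda>t. eh h m r i t * xh h m t ^ a) has_sum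
    ((-1) powi c * h powi (2 * int r * c\<^sup>2 - ((2 * int r - 1) * int m - 2 * int i + 2 * int a) * c + int a * int m)
      * qpochs_inf [q ^ (2 * r), h powi (2 * int r + b), h powi (2 * int r - b)] (q ^ (2 * r)))) UNIV"
proof -
  \<comment> \<open>After t -> t - c the exponent of h is 2r t^2 + b t + d, so g = h^(2r) and w =
    h^b fit the triple product, with h^d left in front.\<close>
  define g where "g = q ^ r"
  define w where "w = h powi b"
  define d where "d = 2 * int r * c\<^sup>2 - ((2 * int r - 1) * int m - 2 * int i + 2 * int a) * c + int a * int m"
  have g: "norm g < 1" "g \<noteq> 0"
    using norm_power_lt_1[of "norm q" r] q r by (auto simp: g_def norm_power)
  have gh: "g = h powi (2 * int r)"
    unfolding g_def q_pow using power_int_of_nat[of h "2 * r"] by simp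
  have w: "w \<noteq> 0" using h_nz by (simp add: w_def)
  have tm: "eh h m r i (t - c) * xh h m (t - c) ^ a = (-1) powi c * h powi d * ((-1) powi t * g powi (t\<^sup>2) * w powi t)" for t
  proof -
    have "(-1::complex) powi (t - c) = (-1) powi t * (-1) powi c"
      by (simp add: power_int_diff divide_inverse power_int_inverse[symmetric])
    moreover have "h powi theta_exp m r i (t - c) * xh h m (t - c) ^ a = h powi d * (g powi (t\<^sup>2) * w powi t)"
      unfolding gh w_def xh_def power_int_power' power_int_mult[symmetric] power_int_add[symmetric, OF disjI1[OF h_nz]]
      by (rule arg_cong[where f = "power_int h"])
         (simp add: theta_exp_def d_def b_def power2_eq_square algebra_simps)
    ultimately show ?thesis unfolding eh_def by (simp only: mult_ac)
  qed
  have "g\<^sup>2 = q ^ (2 * r)" by (simp add: g_def power_mult[symmetric] mult.commute)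
  moreover have "g * w = h powi (2 * int r + b)" "g / w = h powi (2 * int r - b)"
    using h_nz by (simp_all add: gh w_def power_int_add power_int_diff)
  ultimately have gw: "g\<^sup>2 = q ^ (2 * r)" "g * w = h powi (2 * int r + b)" "g / w = h powi (2 * int r - b)"
    by simp_all
  have "((\<lambda>t. eh h m r i (t + - c) * xh h m (t + - c) ^ a) has_sum
      ((-1) powi c * h powi d * qpochs_inf [g\<^sup>2, g * w, g / w] (g\<^sup>2))) UNIV"
    unfolding add_uminus_conv_diff tm by (intro has_sum_cmult_right jacobi_triple_product g w)
  hence "((\<lambda>t. eh h m r i t * xh h m t ^ a) has_sum
      ((-1) powi c * h powi d * qpochs_inf [g\<^sup>2, g * w, g / w] (g\<^sup>2))) UNIV"
    using has_sum_translate_int[of "\<lambda>t. eh h m r i t * xh h m t ^ a" "- c"] by blast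
  thus ?thesis unfolding gw d_def .
qed

text \<open>The series and its reflection add up to 2S; this is the source of the 1/2 in
  c_(2p).\<close>

lemma has_sum_folded_symmetric:
  assumes S: "((\<lambda>t. C * folded_term h m r i t) has_sum S) UNIV"
    and T: "((\<lambda>t. eh h m r i t * ((\<Sum>k\<le>2 * i. xh h m t ^ k) * (\<Sum>l\<le>m. (-1) ^ l * xh h m t ^ l))) has_sum T) UNIV"
  shows "S = C * T / 2"
proof -
  have "((\<lambda>t. C * folded_term h m r i (- int m - t)) has_sum S) UNIV"
    using has_sum_reflect_int[of "\<lambda>t. C * folded_term h m r i t"] S by blast
  from has_sum_add[OF S this]
  have "((\<lambda>t. C * (folded_term h m r i t + folded_term h m r i (- int m - t))) has_sum (S + S)) UNIV"
    by (simp only: distrib_left)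
  hence "((\<lambda>t. C * (eh h m r i t * ((\<Sum>k\<le>2 * i. xh h m t ^ k) * (\<Sum>l\<le>m. (-1) ^ l * xh h m t ^ l)))) has_sum (S + S)) UNIV"
    unfolding folded_term_symmetrise .
  moreover have "((\<lambda>t. C * (eh h m r i t * ((\<Sum>k\<le>2 * i. xh h m t ^ k) * (\<Sum>l\<le>m. (-1) ^ l * xh h m t ^ l)))) has_sum (C * T)) UNIV"
    by (rule has_sum_cmult_right[OF T])
  ultimately have "S + S = C * T" by (rule has_sum_unique)
  hence "C * T / 2 = (S + S) / 2" by simp
  thus ?thesis by simp
qed

lemma folded_sum_even:
  assumes m: "m = 2 * p"
    and S: "((\<lambda>t. qpoch_inf (- (h ^ m)) q / qpoch_inf q q * folded_term h m r i t) has_sum S) UNIV"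
  shows "S = c_even q r i p"
proof -
  define \<Theta> where "\<Theta> k l = q ^ (p * k + p * l) * qpochs_inf
          [q ^ (2 * r),
           q powi (2 * int p * int r + int r - int i - int p + int k + int l),
           q powi (int r + int i - 2 * int p * int r + int p - int k - int l)]
          (q ^ (2 * r))" for k l
  have th: "((\<lambda>t. eh h m r i t * xh h m t ^ (k + l)) has_sum \<Theta> k l) UNIV" for k l
  proof -
    have "h powi (int (k + l) * int m) = q ^ (p * k + p * l)"
      unfolding q_pow unfolding power_int_of_nat[symmetric] by (rule arg_cong[where f = "power_int h"]) (simp add: m algebra_simps)
    thus ?thesis unfolding \<Theta>_def q_powi using has_sum_theta[of "k + l" 0]
      by (simp add: m algebra_simps)
  qed
  have "((\<lambda>t. \<Sum>k\<le>2 * i. \<Sum>l\<le>m. (-1) ^ l * (eh h m r i t * xh h m t ^ (k + l))) has_sum (\<Sum>k\<le>2 * i. \<Sum>l\<le>m. (-1) ^ l * \<Theta> k l)) UNIV"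
    by (intro has_sum_sum has_sum_cmult_right th finite_atMost)
  moreover have "(\<Sum>k\<le>2 * i. \<Sum>l\<le>m. (-1) ^ l * (eh h m r i t * xh h m t ^ (k + l)))
      = eh h m r i t * ((\<Sum>k\<le>2 * i. xh h m t ^ k) * (\<Sum>l\<le>m. (-1) ^ l * xh h m t ^ l))" for t
    unfolding sum_product by (simp only: sum_distrib_left power_add mult_ac)
  ultimately have T: "((\<lambda>t. eh h m r i t * ((\<Sum>k\<le>2 * i. xh h m t ^ k) * (\<Sum>l\<le>m. (-1) ^ l * xh h m t ^ l)))
      has_sum (\<Sum>k\<le>2 * i. \<Sum>l\<le>m. (-1) ^ l * \<Theta> k l)) UNIV" by (simp only:)
  have "h ^ m = q ^ p" by (simp add: m q_pow)
  thus ?thesis using has_sum_folded_symmetric[OF S T]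
    by (simp add: c_even_def \<Theta>_def m atMost_atLeast0 mult_ac)
qed

text \<open>The translation by p removes 4rp from the linear exponent and creates (-1)^p and the
  power of h in front. The reflection of t together with l -> p - l maps the subtracted family to
  the first one with sign (-1)^m = -1, so the two add up and the resulting 2 cancels the
  1/2.\<close>

lemma folded_sum_odd:
  assumes m: "m = 2 * p + 1"
    and S: "((\<lambda>t. qpoch_inf (- (h ^ m)) q / qpoch_inf q q * folded_term h m r i t) has_sum S) UNIV"
  shows "S = c_odd q h r i p"
proof -
  define \<Theta> where "\<Theta> l = (-1) ^ p * h powi (2 * (1 - int r) * (int p)\<^sup>2 + (1 + 2 * int i - 2 * int r) * int p)
      * (q ^ l * qpochs_inf
          [q ^ (2 * r),
           h powi (4 * int r - 2 * int i - 2 * int p + 4 * int l - 1),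
           h powi (2 * int i + 2 * int p - 4 * int l + 1)]
          (q ^ (2 * r)))" for l
  have th: "((\<lambda>t. eh h m r i t * xh h m t ^ (2 * l)) has_sum \<Theta> l) UNIV" for l
  proof -
    have e: "h powi (2 * int r * (int p)\<^sup>2 - ((2 * int r - 1) * int m - 2 * int i + 2 * int (2 * l)) * int p + int (2 * l) * int m)
       = h powi (2 * (1 - int r) * (int p)\<^sup>2 + (1 + 2 * int i - 2 * int r) * int p) * q ^ l"
      unfolding q_pow unfolding power_int_of_nat[symmetric]
      by (rule powi_eq_mult) (auto simp: h_nz m power2_eq_square algebra_simps)
    have b: "(2 * int r - 1) * int m - 2 * int i + 2 * int (2 * l) - 4 * int r * int p
        = 2 * int r - 2 * int i - 2 * int p + 4 * int l - 1"
      by (simp add: m algebra_simps)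
    have b1: "2 * int r + (2 * int r - 2 * int i - 2 * int p + 4 * int l - 1) = 4 * int r - 2 * int i - 2 * int p + 4 * int l - 1"
      and b2: "2 * int r - (2 * int r - 2 * int i - 2 * int p + 4 * int l - 1) = 2 * int i + 2 * int p - 4 * int l + 1"
      by simp_all
    show ?thesis using has_sum_theta[of "2 * l" "int p"] unfolding e b b1 b2 \<Theta>_def
      by (simp only: power_int_of_nat mult_ac)
  qed
  have th': "((\<lambda>t. eh h m r i t * xh h m t ^ (2 * l + 2 * i + 1)) has_sum (- \<Theta> (p - l))) UNIV" if "l \<le> p" for l
  proof -
    have "eh h m r i (- int m - t) * xh h m (- int m - t) ^ (2 * l + 2 * i + 1) = - (eh h m r i t * xh h m t ^ (2 * (p - l)))" for t
    proof -
      have c: "y ^ (a + b) * inverse y ^ b = y ^ a" if "y \<noteq> 0" for y :: complex and a b :: nat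
        using that by (simp add: power_add power_inverse)
      have "m + 2 * i = 2 * (p - l) + (2 * l + 2 * i + 1)" using that m by simp
      hence "xh h m t ^ (m + 2 * i) * inverse (xh h m t) ^ (2 * l + 2 * i + 1) = xh h m t ^ (2 * (p - l))"
        by (simp only: c[OF xh_nz])
      moreover have "(-1::complex) ^ m = -1" by (simp add: m)
      ultimately show ?thesis unfolding eh_reflect xh_reflect by (simp add: mult.assoc)
    qed
    hence "((\<lambda>t. eh h m r i (- int m - t) * xh h m (- int m - t) ^ (2 * l + 2 * i + 1)) has_sum (- \<Theta> (p - l))) UNIV"
      using has_sum_uminusI[OF th] by (simp only:)
    thus ?thesis using has_sum_reflect_int[of "\<lambda>t. eh h m r i t * xh h m t ^ (2 * l + 2 * i + 1)" "- int m"] by blast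
  qed
  have "((\<lambda>t. (\<Sum>l\<le>p. eh h m r i t * xh h m t ^ (2 * l)) - (\<Sum>l\<le>p. eh h m r i t * xh h m t ^ (2 * l + 2 * i + 1)))
      has_sum ((\<Sum>l\<le>p. \<Theta> l) - (\<Sum>l\<le>p. - \<Theta> (p - l)))) UNIV"
    by (intro has_sum_minus has_sum_sum th th') auto
  moreover have "(\<Sum>l\<le>p. eh h m r i t * xh h m t ^ (2 * l)) - (\<Sum>l\<le>p. eh h m r i t * xh h m t ^ (2 * l + 2 * i + 1))
      = eh h m r i t * ((\<Sum>k\<le>2 * i. xh h m t ^ k) * (\<Sum>l\<le>m. (-1) ^ l * xh h m t ^ l))" for t
    unfolding m sum_powers_mult_alternating by (simp only: right_diff_distrib sum_distrib_left)
  ultimately have T: "((\<lambda>t. eh h m r i t * ((\<Sum>k\<le>2 * i. xh h m t ^ k) * (\<Sum>l\<le>m. (-1) ^ l * xh h m t ^ l)))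
      has_sum ((\<Sum>l\<le>p. \<Theta> l) - (\<Sum>l\<le>p. - \<Theta> (p - l)))) UNIV" by (simp only:)
  have "(\<Sum>l\<le>p. \<Theta> (p - l)) = (\<Sum>l\<le>p. \<Theta> l)"
    by (rule sum.nat_diff_reindex[of \<Theta> "Suc p", unfolded lessThan_Suc_atMost diff_Suc_Suc])
  hence d: "(\<Sum>l\<le>p. \<Theta> l) - (\<Sum>l\<le>p. - \<Theta> (p - l)) = 2 * (\<Sum>l\<le>p. \<Theta> l)" by (simp add: sum_negf)
  have "S = qpoch_inf (- (h ^ m)) q / qpoch_inf q q * (\<Sum>l\<le>p. \<Theta> l)"
    using has_sum_folded_symmetric[OF S T] unfolding d by simp
  also have "\<dots> = c_odd q h r i p"
    unfolding c_odd_def \<Theta>_def m sum_distrib_left[symmetric] atMost_atLeast0 by (simp only: mult_ac)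
  finally show ?thesis .
qed

end

end

section \<open>The multiple sum\<close>

text \<open>Tails (s_j, ..., s_r) of the index tuples, so that the multiple sum can be built from
  s_r outwards.\<close>

definition tup :: "int \<Rightarrow> nat \<Rightarrow> nat \<Rightarrow> (nat \<Rightarrow> int) set" where
  "tup lo r j = {s \<in> {j..r} \<rightarrow>\<^sub>E UNIV. (\<forall>k\<in>{j..<r}. s (k + 1) \<le> s k) \<and> lo \<le> s r}"

definition tupn :: "int \<Rightarrow> nat \<Rightarrow> nat \<Rightarrow> int \<Rightarrow> (nat \<Rightarrow> int) set" where
  "tupn lo r j n = {s \<in> tup lo r j. s j = n}"

lemma tup_ge:
  assumes "s \<in> tup lo r j" "j \<le> r"
  shows "lo \<le> s j"
proof -
  have "j \<le> k \<Longrightarrow> lo \<le> s k" if "k \<le> r" for k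
    using that
  proof (induction k rule: inc_induct)
    case base
    thus ?case using assms by (simp add: tup_def)
  next
    case (step k)
    have "s (k + 1) \<le> s k" using assms step by (auto simp: tup_def)
    thus ?case using step by simp
  qed
  thus ?thesis using assms by blast
qed

lemma tupn_base:
  assumes "lo \<le> n"
  shows "tupn lo r r n = {(\<lambda>x. undefined)(r := n)}"
  using assms by (auto simp: tupn_def tup_def PiE_def extensional_def fun_eq_iff)

lemma tupn_step:
  assumes "j < r"
  shows "tupn lo r j n = (\<lambda>s. s(j := n)) ` (\<Union>k\<in>{lo..n}. tupn lo r (Suc j) k)"
proof (intro equalityI subsetI)
  fix s assume s: "s \<in> tupn lo r j n"
  define s' where "s' = s(j := undefined)"
  have "s' \<in> tup lo r (Suc j)"
    using s assms by (auto simp: tupn_def tup_def s'_def PiE_def extensional_def)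
  moreover from this have "lo \<le> s' (Suc j)" using assms by (intro tup_ge[of s' lo r]) auto
  moreover have "s (Suc j) \<le> s j" using s assms by (auto simp: tupn_def tup_def)
  ultimately have "s' \<in> (\<Union>k\<in>{lo..n}. tupn lo r (Suc j) k)"
    using s by (auto simp: tupn_def s'_def)
  moreover have "s = s'(j := n)" using s by (auto simp: s'_def tupn_def)
  ultimately show "s \<in> (\<lambda>s. s(j := n)) ` (\<Union>k\<in>{lo..n}. tupn lo r (Suc j) k)" by blast
next
  fix s assume "s \<in> (\<lambda>s. s(j := n)) ` (\<Union>k\<in>{lo..n}. tupn lo r (Suc j) k)"
  then obtain s' k where s': "s' \<in> tupn lo r (Suc j) k" "k \<le> n" "s = s'(j := n)" by auto
  thus "s \<in> tupn lo r j n" using assms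
    by (auto simp: tupn_def tup_def PiE_def extensional_def)
qed

definition nested_term ::
  "nat \<Rightarrow> (nat \<Rightarrow> int \<Rightarrow> complex) \<Rightarrow> (int \<Rightarrow> complex) \<Rightarrow> (int \<Rightarrow> complex) \<Rightarrow> nat \<Rightarrow> (nat \<Rightarrow> int) \<Rightarrow> complex"
  where "nested_term r w c b j s =
    (\<Prod>k=j..r. w k (s k)) * (\<Prod>k=j..<r. c (s k - s (k + 1))) * b (s r)"

text \<open>Entries of a tail that starts at n lie between lo and n, so there are finitely many
  tails, and descending induction on j adds one entry at a time.\<close>

lemma sum_tupn:
  assumes Fr: "\<And>n. lo \<le> n \<Longrightarrow> F r n = w r n * b n"
    and Fs: "\<And>j n. 1 \<le> j \<Longrightarrow> j < r \<Longrightarrow> lo \<le> n \<Longrightarrow> F j n = w j n * (\<Sum>k\<in>{lo..n}. c (n - k) * F (Suc j) k)"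
    and "1 \<le> j" "j \<le> r" "lo \<le> n"
  shows "finite (tupn lo r j n) \<and> sum (nested_term r w c b j) (tupn lo r j n) = F j n"
  using assms(4,3,5)
proof (induction j arbitrary: n rule: inc_induct)
  case base
  thus ?case by (simp add: tupn_base nested_term_def Fr)
next
  case (step j)
  have inj: "inj_on (\<lambda>s. s(j := n)) (\<Union>k\<in>{lo..n}. tupn lo r (Suc j) k)"
  proof (rule inj_onI)
    fix s s' assume *: "s \<in> (\<Union>k\<in>{lo..n}. tupn lo r (Suc j) k)" "s' \<in> (\<Union>k\<in>{lo..n}. tupn lo r (Suc j) k)"
      and eq: "s(j := n) = s'(j := n)"
    \<comment> \<open>Tails leave position j \<open>undefined\<close>, so overwriting it loses no
      information.\<close>
    have "s j = undefined" "s' j = undefined"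
      using * by (auto simp: tupn_def tup_def PiE_def extensional_def)
    thus "s = s'" using eq by (metis fun_upd_triv fun_upd_upd)
  qed
  have fin: "finite (tupn lo r (Suc j) k)" if "k \<in> {lo..n}" for k
    using step.IH[of k] that by simp
  have tm: "nested_term r w c b j (s(j := n)) = w j n * (c (n - k) * nested_term r w c b (Suc j) s)"
    if "s \<in> tupn lo r (Suc j) k" for s k
  proof -
    have k: "s (Suc j) = k" using that by (simp add: tupn_def)
    have "(\<Prod>k=j..r. w k ((s(j := n)) k)) = w j n * (\<Prod>k=Suc j..r. w k (s k))"
      using step.hyps by (subst prod.atLeast_Suc_atMost) auto
    moreover have "(\<Prod>k=j..<r. c ((s(j := n)) k - (s(j := n)) (k + 1))) = c (n - k) * (\<Prod>k=Suc j..<r. c (s k - s (k + 1)))"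
      using step.hyps k by (subst prod.atLeast_Suc_lessThan) auto
    ultimately show ?thesis using step.hyps by (simp add: nested_term_def)
  qed
  have "sum (nested_term r w c b j) (tupn lo r j n)
      = (\<Sum>s\<in>(\<Union>k\<in>{lo..n}. tupn lo r (Suc j) k). nested_term r w c b j (s(j := n)))"
    unfolding tupn_step[OF step.hyps(2)] by (subst sum.reindex[OF inj]) simp
  also have "\<dots> = (\<Sum>k\<in>{lo..n}. \<Sum>s\<in>tupn lo r (Suc j) k. nested_term r w c b j (s(j := n)))"
    using fin by (intro sum.UNION_disjoint) (auto simp: tupn_def)
  also have "\<dots> = (\<Sum>k\<in>{lo..n}. w j n * (c (n - k) * F (Suc j) k))"
    using step.IH by (intro sum.cong refl) (simp add: tm flip: sum_distrib_left)
  also have "\<dots> = F j n" using Fs[of j n] step.hyps step.prems by (simp add: sum_distrib_left)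
  finally show ?case using fin unfolding tupn_step[OF step.hyps(2)] by auto
qed

text \<open>Groups the tuples by s_1, with finite fibres. Summability is a premise because fibre
  sums, which may involve cancellation, do not control the whole family.\<close>

lemma has_sum_tup:
  assumes Fr: "\<And>n. lo \<le> n \<Longrightarrow> F r n = w r n * b n"
    and Fs: "\<And>j n. 1 \<le> j \<Longrightarrow> j < r \<Longrightarrow> lo \<le> n \<Longrightarrow> F j n = w j n * (\<Sum>k\<in>{lo..n}. c (n - k) * F (Suc j) k)"
    and r: "1 \<le> r"
    and summ: "nested_term r w c b 1 summable_on tup lo r 1"
    and S: "(F 1 has_sum S) {lo..}"
  shows "(nested_term r w c b 1 has_sum S) (tup lo r 1)"
proof -
  from summ obtain S' where S': "(nested_term r w c b 1 has_sum S') (tup lo r 1)"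
    by (auto simp: summable_on_def)
  have bij: "bij_betw snd (Sigma {lo..} (tupn lo r 1)) (tup lo r 1)"
    using r by (intro bij_betwI[of _ _ _ "\<lambda>s. (s 1, s)"]) (auto simp: tupn_def intro: tup_ge)
  have "((\<lambda>x. nested_term r w c b 1 (snd x)) has_sum S') (Sigma {lo..} (tupn lo r 1))"
    unfolding has_sum_reindex_bij_betw[OF bij] by (rule S')
  hence "(F 1 has_sum S') {lo..}"
  proof (rule has_sum_SigmaD)
    fix n assume "n \<in> {lo..}"
    hence *: "finite (tupn lo r 1 n) \<and> sum (nested_term r w c b 1) (tupn lo r 1 n) = F 1 n"
      using r by (intro sum_tupn assms) auto
    thus "((\<lambda>y. nested_term r w c b 1 (snd (n, y))) has_sum F 1 n) (tupn lo r 1 n)"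
      by (intro has_sum_finiteI) auto
  qed
  hence "S' = S" using S has_sum_unique by blast
  thus ?thesis using S' by simp
qed

section \<open>The weights of the theorem as a chain of Bailey steps\<close>

lemma prod_powi:
  fixes x :: complex
  assumes "x \<noteq> 0"
  shows "(\<Prod>k\<in>A. x powi f k) = x powi (\<Sum>k\<in>A. f k)"
  by (induction A rule: infinite_finite_induct) (use assms in \<open>auto simp: power_int_add\<close>)

definition chain_weight :: "complex \<Rightarrow> complex \<Rightarrow> nat \<Rightarrow> nat \<Rightarrow> nat \<Rightarrow> int \<Rightarrow> complex" where
  "chain_weight h q m i j n = (if j = 1 then first_weight h q m i n
     else q powi (n\<^sup>2 + (if j \<le> i then int m - 1 else int m) * n))"

text \<open>Closed form of the sum over s_j, ..., s_r for s_(j-1) = n. Of these indices r - max(i,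
  j-1) have the ordinary weight and i + 1 - j the lowered one, none if j > i by truncated
  subtraction.\<close>

definition chain_beta :: "complex \<Rightarrow> nat \<Rightarrow> nat \<Rightarrow> nat \<Rightarrow> nat \<Rightarrow> int \<Rightarrow> complex" where
  "chain_beta q m r i j n = (\<Sum>t\<in>{- int m - n..n}.
     balpha q t * q powi (int (r - max i (j - 1)) * (t\<^sup>2 + int m * t)) * bG q m (i + 1 - j) n t)"

text \<open>Once the finite sums over k and t are exchanged, each t undergoes a single step:
  \<open>bG_step\<close> if j <= i, \<open>bailey_step\<close> otherwise.\<close>

lemma chain_beta_step:
  assumes q: "norm q < 1" "q \<noteq> 0" and j: "2 \<le> j" "j \<le> r" and i: "i \<le> r"
  shows "(\<Sum>k\<in>{- int (m div 2)..n}. rq q (n - k) * (q powi (k\<^sup>2 + (if j \<le> i then int m - 1 else int m) * k)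
      * chain_beta q m r i (Suc j) k)) = chain_beta q m r i j n"
proof -
  define wt where "wt k = q powi (k\<^sup>2 + (if j \<le> i then int m - 1 else int m) * k)" for k
  define A where "A t = balpha q t * q powi (int (r - max i j) * (t\<^sup>2 + int m * t))" for t
  \<comment> \<open>The range of t depends on k; it is widened to a common one, the kernel being 0
    on the difference.\<close>
  have ext: "chain_beta q m r i (Suc j) k = (\<Sum>t\<in>{- int m - n..n}. A t * bG q m (i - j) k t)" if "k \<le> n" for k
    unfolding chain_beta_def A_def
    by (rule sum.mono_neutral_cong_left) (use that in \<open>auto simp: bG_def bU_def rq_def\<close>)
  have step: "A t * (\<Sum>k\<in>{- int (m div 2)..n}. wt k * rq q (n - k) * bG q m (i - j) k t)
      = balpha q t * q powi (int (r - max i (j - 1)) * (t\<^sup>2 + int m * t)) * bG q m (i + 1 - j) n t" for t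
  proof (cases "j \<le> i")
    case True
    hence "i + 1 - j = Suc (i - j)" "max i (j - 1) = i" "max i j = i" by auto
    thus ?thesis using True bG_step[OF q, of m n "i - j" t] by (simp add: wt_def A_def)
  next
    case False
    have e: "int (r - max i (j - 1)) = int (r - max i j) + 1" using False j by auto
    have "q powi (int (r - max i (j - 1)) * (t\<^sup>2 + int m * t))
        = q powi (int (r - max i j) * (t\<^sup>2 + int m * t)) * q powi (t\<^sup>2 + int m * t)"
      unfolding e by (rule powi_eq_mult) (use q in \<open>auto simp: algebra_simps\<close>)
    moreover have "i - j = 0" "i + 1 - j = 0" using False by auto
    ultimately show ?thesis using False bailey_step[OF q, of m n t] by (simp add: wt_def A_def bG_0)
  qed
  have "(\<Sum>k\<in>{- int (m div 2)..n}. rq q (n - k) * (wt k * chain_beta q m r i (Suc j) k))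
      = (\<Sum>k\<in>{- int (m div 2)..n}. \<Sum>t\<in>{- int m - n..n}. A t * (wt k * rq q (n - k) * bG q m (i - j) k t))"
    by (intro sum.cong refl) (simp add: ext sum_distrib_left mult_ac)
  also have "\<dots> = (\<Sum>t\<in>{- int m - n..n}. A t * (\<Sum>k\<in>{- int (m div 2)..n}. wt k * rq q (n - k) * bG q m (i - j) k t))"
    unfolding sum_distrib_left by (rule sum.swap)
  also have "\<dots> = chain_beta q m r i j n" unfolding step chain_beta_def ..
  finally show ?thesis unfolding wt_def .
qed

definition chain_bottom :: "complex \<Rightarrow> nat \<Rightarrow> int \<Rightarrow> complex" where
  "chain_bottom q m n = (-1) powi n * q powi (n * (n - 1) div 2) * qbinom q (int m + n) (int m + 2 * n)"

text \<open>For n > 0 the q-binomial coefficient has m + 2n > m + n and is 0, so only finitely many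
  n matter.\<close>

lemma chain_bottom_bounded:
  obtains K where "K > 0" "\<And>n. - int (m div 2) \<le> n \<Longrightarrow> norm (chain_bottom q m n) \<le> K"
proof -
  define A where "A = (\<lambda>n. norm (chain_bottom q m n)) ` {- int (m div 2)..0}"
  have fin: "finite A" "A \<noteq> {}" by (auto simp: A_def)
  show ?thesis
  proof (rule that[of "\<bar>Max A\<bar> + 1"])
    fix n assume n: "- int (m div 2) \<le> n"
    show "norm (chain_bottom q m n) \<le> \<bar>Max A\<bar> + 1"
    proof (cases "n \<le> 0")
      case True
      hence "norm (chain_bottom q m n) \<le> Max A" using n fin by (intro Max_ge) (auto simp: A_def)
      thus ?thesis by linarith
    qed (simp add: chain_bottom_def qbinom_def)
  qed auto
qed

context half_base
begin

lemma prod_chain_weight: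
  assumes r: "2 \<le> r" "i \<le> r - 1"
  shows "(\<Prod>k=1..r. chain_weight h q m i k (s k)) = h powi twice_exponent m r i s * qpoch (- (h ^ m)) q (s 1)"
proof -
  note h = h_nz
  define f where "f k = 2 * ((s k)\<^sup>2 + (if k \<le> i then int m - 1 else int m) * s k)" for k
  have "(\<Prod>k=1..r. chain_weight h q m i k (s k)) = first_weight h q m i (s 1) * (\<Prod>k=2..r. h powi f k)"
  proof -
    have "(\<Prod>k=1..r. chain_weight h q m i k (s k)) = chain_weight h q m i 1 (s 1) * (\<Prod>k=Suc 1..r. chain_weight h q m i k (s k))"
      using r by (intro prod.atLeast_Suc_atMost) auto
    also have "(\<Prod>k=Suc 1..r. chain_weight h q m i k (s k)) = (\<Prod>k=2..r. h powi f k)"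
      by (intro prod.cong) (auto simp: chain_weight_def f_def q_powi)
    finally show ?thesis by (simp add: chain_weight_def)
  qed
  also have "(\<Prod>k=2..r. h powi f k) = h powi (\<Sum>k=2..r. f k)" by (rule prod_powi[OF h])
  finally have 1: "(\<Prod>k=1..r. chain_weight h q m i k (s k))
      = h powi ((s 1)\<^sup>2 + (if i = 0 then int m + 1 else int m - 1) * s 1) * h powi (\<Sum>k=2..r. f k) * qpoch (- (h ^ m)) q (s 1)"
    by (simp add: first_weight_def mult_ac)
  have si: "(\<Sum>j=1..i. s j) = (if i = 0 then 0 else s 1) + (\<Sum>k=2..r. if k \<le> i then s k else 0)"
  proof (cases "i = 0")
    case False
    have "(\<Sum>k=2..r. if k \<le> i then s k else 0) = (\<Sum>k=2..i. s k)"
      using r by (intro sum.mono_neutral_cong_right) auto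
    moreover have "(\<Sum>j=1..i. s j) = s 1 + (\<Sum>k=Suc 1..i. s k)"
      using False by (intro sum.atLeast_Suc_atMost) auto
    ultimately show ?thesis using False by (simp add: numeral_2_eq_2)
  qed (auto intro: sum.neutral[symmetric])
  have fk: "f k = 2 * (s k)\<^sup>2 + 2 * int m * s k - 2 * (if k \<le> i then s k else 0)" for k
    by (simp add: f_def algebra_simps)
  have "twice_exponent m r i s = (s 1)\<^sup>2 + (if i = 0 then int m + 1 else int m - 1) * s 1 + (\<Sum>k=2..r. f k)"
    unfolding twice_exponent_def si fk sum.distrib sum_subtractf sum_distrib_left[symmetric]
    by (simp add: algebra_simps)
  from powi_eq_mult[OF h this] show ?thesis unfolding 1 by simp
qed

text \<open>Each weight is at most K |h|^|s_k|, so a product of geometric series over all integer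
  tuples dominates, whatever the order of the entries. The bound on the first weight needs s_1 >=
  -floor(m/2).\<close>

lemma summable_chain:
  assumes r: "1 \<le> r"
  shows "nested_term r (chain_weight h q m i) (rq q) (chain_bottom q m) 1 summable_on tup (- int (m div 2)) r 1"
proof -
  define L where "L = - int (m div 2)"
  note h = h_nz and nh = norm_h
  obtain K1 where K1: "K1 > 0" "\<And>n. L \<le> n \<Longrightarrow> norm (first_weight h q m i n) \<le> K1 * norm h ^ nat \<bar>n\<bar>"
    unfolding first_weight_def L_def using last_weight_bound by metis
  obtain K3 where K3: "K3 > 0" "\<And>k. norm (rq q k) \<le> K3" using rq_bounded[OF q(1)] by metis
  obtain K4 where K4: "K4 > 0" "\<And>n. L \<le> n \<Longrightarrow> norm (chain_bottom q m n) \<le> K4"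
    unfolding L_def using chain_bottom_bounded by metis
  define c where "c = (2 * int m + 2 + 1)\<^sup>2"
  define K where "K = K1 + norm h powi (- c)"
  have K2: "norm h powi (- c) > 0" using h by (intro zero_less_power_int) auto
  have wb: "norm (chain_weight h q m i k n) \<le> K * norm h ^ nat \<bar>n\<bar>" if "k = 1 \<Longrightarrow> L \<le> n" for k n
  proof (cases "k = 1")
    case True
    have "norm (chain_weight h q m i k n) \<le> K1 * norm h ^ nat \<bar>n\<bar>"
      using K1 that True by (simp add: chain_weight_def)
    also have "\<dots> \<le> K * norm h ^ nat \<bar>n\<bar>" using K2 by (intro mult_right_mono) (auto simp: K_def)
    finally show ?thesis .
  next
    case False
    define b where "b = 2 * (if k \<le> i then int m - 1 else int m)"
    have "chain_weight h q m i k n = h powi (2 * n\<^sup>2 + b * n)"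
      using False by (simp add: chain_weight_def q_powi b_def algebra_simps)
    also have "norm \<dots> \<le> norm h powi (- c) * norm h ^ nat \<bar>n\<bar>"
      unfolding c_def by (intro norm_powi_le nh h quadratic_ge_abs) (auto simp: b_def)
    also have "\<dots> \<le> K * norm h ^ nat \<bar>n\<bar>" using K1 by (intro mult_right_mono) (auto simp: K_def)
    finally show ?thesis .
  qed
  have "(\<lambda>s. \<Prod>k\<in>{1..r}. norm h ^ nat \<bar>s k\<bar>) summable_on ({1..r} \<rightarrow>\<^sub>E UNIV)"
    using nh by (intro summable_prod_tuples summable_geometric_int) auto
  hence "(\<lambda>s. \<Prod>k\<in>{1..r}. norm h ^ nat \<bar>s k\<bar>) summable_on tup L r 1"
    by (rule summable_on_subset_banach) (auto simp: tup_def)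
  hence "(\<lambda>s. (K ^ r * K3 ^ (r - 1) * K4) * (\<Prod>k\<in>{1..r}. norm h ^ nat \<bar>s k\<bar>)) summable_on tup L r 1"
    by (rule summable_on_cmult_right)
  hence "(\<lambda>s. norm (nested_term r (chain_weight h q m i) (rq q) (chain_bottom q m) 1 s)) summable_on tup L r 1"
  proof (rule Infinite_Sum.abs_summable_on_comparison_test')
    fix s assume s: "s \<in> tup L r 1"
    have s1: "L \<le> s 1" using s r by (intro tup_ge)
    have sr: "L \<le> s r" using s by (simp add: tup_def)
    have "norm (\<Prod>k=1..r. chain_weight h q m i k (s k)) \<le> (\<Prod>k=1..r. K * norm h ^ nat \<bar>s k\<bar>)"
      unfolding prod_norm[symmetric] using s1 wb by (intro prod_mono) auto
    also have "\<dots> = K ^ r * (\<Prod>k=1..r. norm h ^ nat \<bar>s k\<bar>)" by (simp add: prod.distrib)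
    finally have 1: "norm (\<Prod>k=1..r. chain_weight h q m i k (s k)) \<le> K ^ r * (\<Prod>k=1..r. norm h ^ nat \<bar>s k\<bar>)" .
    have "norm (\<Prod>k=1..<r. rq q (s k - s (k + 1))) \<le> (\<Prod>k=1..<r. K3)"
      unfolding prod_norm[symmetric] using K3 by (intro prod_mono) auto
    hence 2: "norm (\<Prod>k=1..<r. rq q (s k - s (k + 1))) \<le> K3 ^ (r - 1)" by simp
    have "norm (nested_term r (chain_weight h q m i) (rq q) (chain_bottom q m) 1 s)
       \<le> (K ^ r * (\<Prod>k=1..r. norm h ^ nat \<bar>s k\<bar>)) * K3 ^ (r - 1) * K4"
      unfolding nested_term_def norm_mult using K1 K2 K3 K4(2)[OF sr]
      by (intro mult_mono 1 2) (auto simp: K_def intro!: mult_nonneg_nonneg prod_nonneg)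
    thus "norm (nested_term r (chain_weight h q m i) (rq q) (chain_bottom q m) 1 s)
       \<le> (K ^ r * K3 ^ (r - 1) * K4) * (\<Prod>k\<in>{1..r}. norm h ^ nat \<bar>s k\<bar>)" by (simp only: mult_ac)
  qed
  from abs_summable_summable[OF this] show ?thesis unfolding L_def .
qed

end

theorem theorem2p9:
  fixes q h :: complex and m r i :: nat
  assumes "norm q < 1" and "q \<noteq> 0" and "h\<^sup>2 = q"
    and "2 \<le> r" and "i \<le> r - 1"
  shows "((\<lambda>s. h powi twice_exponent m r i s * qpoch (- (h ^ m)) q (s 1)
              / (\<Prod>j=1..<r. qpoch q q (s j - s (j + 1)))
              * (-1) powi s r * q powi (s r * (s r - 1) div 2)
              * qbinom q (int m + s r) (int m + 2 * s r))
          has_sum c_val q h r i m) (index_tuples m r)"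
proof -
  note q = assms(1,2) and hq = assms(3) and r = assms(4,5)
  interpret half_base h q by unfold_locales (use hq q in auto)
  define L where "L = - int (m div 2)"
  define w where "w = chain_weight h q m i"
  \<comment> \<open>The sum over s_(j+1), ..., s_r for s_j = n, times the weight of s_j.\<close>
  define F where "F j n = w j n * chain_beta q m r i (Suc j) n" for j n
  obtain S where S: "((\<lambda>n. first_weight h q m i n *
        (\<Sum>t\<in>{- int m - n..n}. outer_alpha q m r i t * bG q m (i - 1) n t)) has_sum S) {L..}"
    and S': "((\<lambda>t. qpoch_inf (- (h ^ m)) q / qpoch_inf q q * folded_term h m r i t) has_sum S) UNIV"
    unfolding L_def using has_sum_double[OF r] by blast
  have val: "S = c_val q h r i m"
  proof (cases "even m")
    case True
    hence "m = 2 * (m div 2)" by simp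
    from folded_sum_even[OF _ this S'] show ?thesis using True r by (simp add: c_val_def)
  next
    case False
    hence "m = 2 * (m div 2) + 1" by simp
    from folded_sum_odd[OF _ this S'] show ?thesis using False r by (simp add: c_val_def)
  qed
  have F1: "(F 1 has_sum S) {L..}"
  proof -
    have "F 1 = (\<lambda>n. first_weight h q m i n *
        (\<Sum>t\<in>{- int m - n..n}. outer_alpha q m r i t * bG q m (i - 1) n t))"
      unfolding F_def chain_beta_def outer_alpha_def w_def
      by (auto simp: chain_weight_def fun_eq_iff numeral_2_eq_2[symmetric])
    thus ?thesis using S by simp
  qed
  have "(nested_term r w (rq q) (chain_bottom q m) 1 has_sum S) (tup L r 1)"
  proof (rule has_sum_tup[where F = F])
    fix n assume n: "L \<le> n"
    \<comment> \<open>Nothing has been summed yet: both step counts are 0, and only the bilateral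
      transform of the pair remains.\<close>
    have "chain_beta q m r i (Suc r) n = chain_bottom q m n"
      using bailey_pair_finite[OF q, of m n] n r
      by (simp add: chain_beta_def chain_bottom_def L_def bG_0)
    thus "F r n = w r n * chain_bottom q m n" by (simp add: F_def)
  next
    fix j n assume j: "1 \<le> j" "j < r"
    have "F (Suc j) k = q powi (k\<^sup>2 + (if Suc j \<le> i then int m - 1 else int m) * k) * chain_beta q m r i (Suc (Suc j)) k" for k
      using j by (simp add: F_def w_def chain_weight_def)
    thus "F j n = w j n * (\<Sum>k\<in>{L..n}. rq q (n - k) * F (Suc j) k)"
      using chain_beta_step[OF q, where j = "Suc j" and r = r and i = i and m = m and n = n] j r unfolding F_def[of j] L_def by simp
  next
    show "nested_term r w (rq q) (chain_bottom q m) 1 summable_on tup L r 1"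
      unfolding w_def L_def using r by (intro summable_chain) auto
  qed (use F1 r in auto)
  moreover have "nested_term r w (rq q) (chain_bottom q m) 1 s =
     h powi twice_exponent m r i s * qpoch (- (h ^ m)) q (s 1)
              / (\<Prod>j=1..<r. qpoch q q (s j - s (j + 1)))
              * (-1) powi s r * q powi (s r * (s r - 1) div 2)
              * qbinom q (int m + s r) (int m + 2 * s r)" if "s \<in> tup L r 1" for s
  proof -
    \<comment> \<open>The ordering of the tuple gives the nonnegative differences that
      \<open>inverse_qpoch_q\<close> requires.\<close>
    have "(\<Prod>k=1..<r. rq q (s k - s (k + 1))) = (\<Prod>k=1..<r. inverse (qpoch q q (s k - s (k + 1))))"
      using that by (intro prod.cong refl inverse_qpoch_q[symmetric] q) (auto simp: tup_def)
    also have "\<dots> = inverse (\<Prod>k=1..<r. qpoch q q (s k - s (k + 1)))" using prod_inversef[of "\<lambda>k. qpoch q q (s k - s (k + 1))"] by (simp add: o_def)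
    finally show ?thesis
      unfolding nested_term_def w_def prod_chain_weight[OF r] chain_bottom_def
      by (simp only: divide_inverse mult_ac)
  qed
  moreover have "tup L r 1 = index_tuples m r" by (simp add: tup_def index_tuples_def L_def)
  ultimately show ?thesis unfolding val using has_sum_cong by (smt (verit))
qed

end
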